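(* Let $\mathcal{C}$ be a clean tangled clutter. Then $\mathrm{conv}(\mathrm{setcore}(\mathcal{C}))$ is a simplex if, and only if, $\mathrm{setcore}(\mathcal{C})$ is (up to isomorphism) the cocycle space of a projective geometry, i.e. is isomorphic to $\mathrm{cocycle}(PG(k-1,2))$ for some integer $k\ge 1$.
   Context: Clutters. A clutter over a finite ground set $V$ is a family $\mathcal{C}$ of subsets of $V$ (its members), none of which contains another. A cover is a subset of $V$ that intersects every member; the blocker $b(\mathcal{C})$ is the clutter over $V$ of the inclusion-wise minimal covers. The covering number $\tau(\mathcal{C})$ is the minimum cardinality of a cover; a minimum cover is a cover of cardinality $\tau(\mathcal{C})$. For disjoint $I,J\subseteq V$, the minor $\mathcal{C}\setminus I/J$ (delete $I$, contract $J$) is the clutter over $V-(I\cup J)$ whose members are the inclusion-wise minimal sets in $\{C-J: C\in\mathcal{C},\ C\cap I=\emptyset\}$. Clutters are identified up to relabeling of the ground set. Clean, tangled. A delta is a clutter over a ground set $\{a_1,\dots,a_n\}$, $n\ge 3$, whose members are $\{a_2,\dots,a_n\}$ and $\{a_1,a_i\}$, $i=2,\dots,n$. An extended odd hole is a clutter over a ground set $\{a_1,\dots,a_n\}$, $n\ge5$ odd, whose minimum cardinality members are exactly $\{a_1,a_2\},\{a_2,a_3\},\dots,\{a_{n-1},a_n\},\{a_n,a_1\}$ (other members of cardinality at least three may exist). A clutter is clean if it has no minor that is a delta or the blocker of an extended odd hole. A clutter is tangled if its covering number is two and every element belongs to a minimum cover. Core and setcore. A fractional packing of $\mathcal{C}$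 is a vector $y\in\mathbb{R}^{\mathcal{C}}_+$ with $\sum(y_C: v\in C\in\mathcal{C})\le 1$ for all $v\in V$; its value is $\sum_C y_C$. Let $\mathcal{C}$ be clean tangled over $V$. $\mathrm{core}(\mathcal{C})=\{C\in\mathcal{C}: y_C>0\text{ for some fractional packing }y\text{ of value two}\}$. $G(\mathcal{C})$ is the graph on vertex set $V$ whose edges are the minimum covers of $\mathcal{C}$; it is known to be bipartite with no isolated vertex. The rank $r$ of $\mathcal{C}$ is its number of connected components; let $\{U_i,V_i\}$ be the bipartition of the $i$-th component, $i\in[r]$. Every $C\in\mathrm{core}(\mathcal{C})$ satisfies $C\cap(U_i\cup V_i)\in\{U_i,V_i\}$ for all $i$, and $\mathrm{setcore}(\mathcal{C})\subseteq\{0,1\}^r$ is the set of points $p$ obtained from the members $C\in\mathrm{core}(\mathcal{C})$ by letting $p_i=0$ if $C\cap(U_i\cup V_i)=U_i$ and $p_i=1$ if $C\cap(U_i\cup V_i)=V_i$. It is determined up to isomorphism, where two sets in $\{0,1\}^r$ are isomorphic if one is obtained from the other by permuting coordinates and twisting some coordinates (twisting $i$ means replacing $p_i$ by $1-p_i$ for all points). Projective geometries. For $k\ge1$ let $A$ be the $k\times(2^k-1)$ matrix whose columns are all nonzero vectors of $\{0,1\}^k$. $PG(k-1,2)$ is the binary matroid represented by $A$, and $\mathrm{cocycle}(PG(k-1,2))=\{A^\top y \bmod 2: y\in\{0,1\}^k\}\subseteq\{0,1\}^{2^k-1}$. *)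

theory Defs
  imports "HOL-Analysis.Analysis"
begin

definition minimal_sets :: "'a set set \<Rightarrow> 'a set set" where
  "minimal_sets F = {X \<in> F. \<forall>Y\<in>F. Y \<subseteq> X \<longrightarrow> Y = X}"

definition clutter :: "'a set \<Rightarrow> 'a set set \<Rightarrow> bool" where
  "clutter V C \<longleftrightarrow>
     finite V \<and> (\<forall>M\<in>C. M \<subseteq> V) \<and> (\<forall>M\<in>C. \<forall>N\<in>C. M \<subseteq> N \<longrightarrow> M = N)"

definition covers :: "'a set \<Rightarrow> 'a set set \<Rightarrow> 'a set set" where
  "covers V C = {B. B \<subseteq> V \<and> (\<forall>M\<in>C. B \<inter> M \<noteq> {})}"

definition blocker :: "'a set \<Rightarrow> 'a set set \<Rightarrow> 'a set set" where
  "blocker V C = minimal_sets (covers V C)"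

(* Extended naturals, so that the covering number of the clutter {{}}, which has no cover,
   is infinite rather than an unspecified number. *)
definition covering_number :: "'a set \<Rightarrow> 'a set set \<Rightarrow> enat" where
  "covering_number V C = (INF B\<in>covers V C. enat (card B))"

definition minimum_covers :: "'a set \<Rightarrow> 'a set set \<Rightarrow> 'a set set" where
  "minimum_covers V C = {B \<in> covers V C. enat (card B) = covering_number V C}"

(* Delete I, contract J; the ground set of the minor is V - (I \<union> J). *)
definition minor :: "'a set set \<Rightarrow> 'a set \<Rightarrow> 'a set \<Rightarrow> 'a set set" where
  "minor C I J = minimal_sets {M - J | M. M \<in> C \<and> M \<inter> I = {}}"

(* The classes of deltas and of extended odd holes are closed under relabeling, because the
   enumeration a of the ground set is arbitrary. *)
definition is_delta :: "'a set \<Rightarrow> 'a set set \<Rightarrow> bool" where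
  "is_delta V C \<longleftrightarrow>
     (\<exists>n a. n \<ge> (3::nat) \<and> bij_betw a {1..n} V \<and>
        C = insert (a ` {2..n}) {{a 1, a i} | i. i \<in> {2..n}})"

definition is_extended_odd_hole :: "'a set \<Rightarrow> 'a set set \<Rightarrow> bool" where
  "is_extended_odd_hole V C \<longleftrightarrow> clutter V C \<and>
     (\<exists>n a. n \<ge> (5::nat) \<and> odd n \<and> bij_betw a {1..n} V \<and>
        {M \<in> C. \<forall>N\<in>C. card M \<le> card N} =
          insert {a n, a 1} {{a i, a (i + 1)} | i. i \<in> {1..<n}})"

definition clean :: "'a set \<Rightarrow> 'a set set \<Rightarrow> bool" where
  "clean V C \<longleftrightarrow>
     (\<forall>I J. I \<subseteq> V \<longrightarrow> J \<subseteq> V \<longrightarrow> I \<inter> J = {} \<longrightarrow>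
        \<not> is_delta (V - (I \<union> J)) (minor C I J) \<and>
        \<not> (\<exists>D. is_extended_odd_hole (V - (I \<union> J)) D \<and>
               minor C I J = blocker (V - (I \<union> J)) D))"

definition tangled :: "'a set \<Rightarrow> 'a set set \<Rightarrow> bool" where
  "tangled V C \<longleftrightarrow>
     covering_number V C = 2 \<and> (\<forall>v\<in>V. \<exists>B\<in>minimum_covers V C. v \<in> B)"

definition fractional_packing :: "'a set \<Rightarrow> 'a set set \<Rightarrow> ('a set \<Rightarrow> real) \<Rightarrow> bool" where
  "fractional_packing V C y \<longleftrightarrow>
     (\<forall>M\<in>C. 0 \<le> y M) \<and> (\<forall>v\<in>V. (\<Sum>M | M \<in> C \<and> v \<in> M. y M) \<le> 1)"

definition core :: "'a set \<Rightarrow> 'a set set \<Rightarrow> 'a set set" where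
  "core V C = {M \<in> C. \<exists>y. fractional_packing V C y \<and> (\<Sum>N\<in>C. y N) = 2 \<and> y M > 0}"

(* Vertex sets of the connected components of the graph G(C), whose vertex set is V and whose
   edges are the minimum covers. *)
definition G_components :: "'a set \<Rightarrow> 'a set set \<Rightarrow> 'a set set" where
  "G_components V C =
     V // {(u, v). u \<in> V \<and> v \<in> V \<and> (u, v) \<in> {(s, t). {s, t} \<in> minimum_covers V C}\<^sup>*}"

(* The finite type 'r indexes the connected components of G(C), each exactly once, so CARD('r)
   is the rank; U i and W i are the two colour classes of the i-th component. *)
definition component_bipartitions ::
  "'a set \<Rightarrow> 'a set set \<Rightarrow> ('r::finite \<Rightarrow> 'a set) \<Rightarrow> ('r \<Rightarrow> 'a set) \<Rightarrow> bool" where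
  "component_bipartitions V C U W \<longleftrightarrow>
     bij_betw (\<lambda>i. U i \<union> W i) UNIV (G_components V C) \<and>
     (\<forall>i. U i \<inter> W i = {} \<and>
          (\<forall>e\<in>minimum_covers V C. e \<subseteq> U i \<union> W i \<longrightarrow>
             card (e \<inter> U i) = 1 \<and> card (e \<inter> W i) = 1))"

definition setcore ::
  "'a set \<Rightarrow> 'a set set \<Rightarrow> ('r::finite \<Rightarrow> 'a set) \<Rightarrow> ('r \<Rightarrow> 'a set) \<Rightarrow> (real^'r) set" where
  "setcore V C U W =
     {p. \<exists>M\<in>core V C. \<forall>i.
           (M \<inter> (U i \<union> W i) = U i \<and> p $ i = 0) \<or> (M \<inter> (U i \<union> W i) = W i \<and> p $ i = 1)}"

definition binary_vectors :: "nat \<Rightarrow> (nat \<Rightarrow> nat) set" where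
  "binary_vectors k = {..<k} \<rightarrow>\<^sub>E {0, 1}"

(* The columns of the matrix A representing PG(k-1,2). They are pairwise distinct, so each
   column serves as its own index, and {0,1}^(2^k-1) is the set of 0/1 functions on PG_columns k. *)
definition PG_columns :: "nat \<Rightarrow> (nat \<Rightarrow> nat) set" where
  "PG_columns k = {c \<in> binary_vectors k. \<exists>j<k. c j \<noteq> 0}"

lemma card_PG_columns: "card (PG_columns k) = 2 ^ k - 1"
proof -
  let ?z = "\<lambda>j\<in>{..<k}. 0 :: nat"
  have z: "?z \<in> binary_vectors k"
    by (auto simp: binary_vectors_def)
  have "PG_columns k = binary_vectors k - {?z}"
    by (force simp: PG_columns_def binary_vectors_def PiE_def extensional_def restrict_def)
  moreover have "card (binary_vectors k) = 2 ^ k"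
    by (simp add: binary_vectors_def card_PiE numeral_2_eq_2)
  ultimately show ?thesis
    using z by simp
qed

definition cocycle_PG :: "nat \<Rightarrow> ((nat \<Rightarrow> nat) \<Rightarrow> nat) set" where
  "cocycle_PG k =
     {(\<lambda>c\<in>PG_columns k. (\<Sum>j<k. c j * y j) mod 2) | y. y \<in> binary_vectors k}"

(* S is a set of 0/1 points with coordinates indexed by 'r, and T one with coordinates indexed
   by J. The bijection \<sigma> matches the coordinates, and the coordinates in F are twisted. *)
definition cube_isomorphic :: "(real^'r::finite) set \<Rightarrow> 'j set \<Rightarrow> ('j \<Rightarrow> nat) set \<Rightarrow> bool" where
  "cube_isomorphic S J T \<longleftrightarrow>
     (\<exists>\<sigma> F. bij_betw \<sigma> UNIV J \<and>
        S = (\<lambda>q. \<chi> i. if i \<in> F then 1 - real (q (\<sigma> i)) else real (q (\<sigma> i))) ` T)"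

end

theory Submission
  imports Defs
begin

text \<open>
A clutter is studied through the family \<open>K\<close> of all its covers. In these terms deleting \<open>I\<close> and
contracting \<open>J\<close> keeps the sets \<open>B\<close> of remaining elements with \<open>B \<union> I \<in> K\<close>, the edges of the
graph of a tangled clutter are its two-element covers, and cleanness forbids two patterns in every
minor whose covers all have at least two elements.

The combinatorial heart is that no cover lies inside one colour class of a component of the graph
(\<open>no_member_in_side\<close>), even after adding one element outside the component
(\<open>no_member_in_side_insert\<close>). Both follow from \<open>no_member_joined_by_alternating_walk\<close>, which
shortens a walk inside suitable minors until a delta or an odd closed walk appears. Hence deleting
one colour class of a component and contracting the other leaves a clutter in which, again, covers
have at least two elements and every element is on an edge (\<open>tangled_side_minor\<close>); its edges include
those off the component, and further edges may have merged the other components.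

Call a set that avoids no cover and has exactly one end of every edge a transversal. A transversal
of the minor together with the contracted class is a transversal of the clutter. By induction, and
by averaging over the two choices of the contracted class, there is a probability distribution on
transversals under which every element has probability 1/2. Doubled, it is a fractional
packing of value two, so it lives on the core. Let \<open>s\<^sub>i = \<plusminus>1\<close> record the colour class of the
component \<open>i\<close> that a member of the core contains. The construction fixes the class of a chosen
component \<open>i\<close> and can be iterated, so for distinct \<open>i, j\<close> the mean of \<open>s\<^sub>i s\<^sub>j\<close> can be made 0, and
for distinct \<open>i, j, k\<close> the mean of \<open>s\<^sub>i s\<^sub>j s\<^sub>k\<close> can be made -1, 0 or 1 as soon as that of
\<open>s\<^sub>j s\<^sub>k\<close> is 0: after fixing \<open>i\<close>, the components \<open>j\<close> and \<open>k\<close> have either merged or remain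
independent (\<open>pair_mean\<close>, \<open>triple_mean\<close>).

If the set core spans a simplex, its points are affinely independent, so there is only one
distribution with all means of the \<open>s\<^sub>i\<close> equal to 0, and it has all these properties at once. With
respect to it \<open>1, s\<^sub>1, \<dots>, s\<^sub>r\<close> are orthonormal functions on at most \<open>r + 1\<close> points, hence a basis.
The coefficients of \<open>s\<^sub>i s\<^sub>j\<close> in this basis lie in {-1, 0, 1} and their squares add up to 1, so
\<open>s\<^sub>i s\<^sub>j\<close> is one of the \<open>s\<^sub>k\<close> up to sign. After a twist that moves a point of the set core to the
origin, \<open>1, s\<^sub>1, \<dots>, s\<^sub>r\<close> form an elementary abelian 2-group, the coordinates become its nonzero
elements, and the \<open>r + 1\<close> points become its characters: this is the cocycle space of a projective
geometry (\<open>balanced_simplex_is_cocycle\<close>). Conversely, the points of such a cocycle space are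
affinely independent by the orthogonality of characters (\<open>cocycle_affine_independent\<close>).
\<close>

section \<open>Families of covers and their minors\<close>

text \<open>If \<open>K\<close> is the family of covers of a clutter, this is the family of covers of the minor over
  \<open>R\<close> obtained by deleting \<open>Q\<close> and contracting the other elements.\<close>

definition cover_minor :: "'a set set \<Rightarrow> 'a set \<Rightarrow> 'a set \<Rightarrow> 'a set set" where
  "cover_minor K Q R = {B. B \<subseteq> R \<and> B \<union> Q \<in> K}"

definition no_small :: "'a set set \<Rightarrow> bool" where
  "no_small K \<longleftrightarrow> {} \<notin> K \<and> (\<forall>v. {v} \<notin> K)"

text \<open>In an upward closed family over \<open>R\<close> without members of size at most one, these conditions
  say that \<open>K\<close> consists of the covers of a delta with centre \<open>t\<close>.\<close>

definition delta_covers :: "'a set \<Rightarrow> 'a set set \<Rightarrow> bool" where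
  "delta_covers R K \<longleftrightarrow> (\<exists>t X. R = insert t X \<and> t \<notin> X \<and> X \<in> K \<and>
     (\<forall>Y\<in>K. Y \<subseteq> X \<longrightarrow> Y = X) \<and> (\<forall>x\<in>X. {t, x} \<in> K))"

text \<open>In the same setting, the two-element members are the edges of an odd cycle of length at
  least five, so the minimal members of \<open>K\<close> form an extended odd hole and \<open>K\<close> consists of the covers of its blocker.\<close>

definition odd_hole_covers :: "'a set \<Rightarrow> 'a set set \<Rightarrow> bool" where
  "odd_hole_covers R K \<longleftrightarrow> (\<exists>n a. n \<ge> (5::nat) \<and> odd n \<and> bij_betw a {..<n} R \<and>
     (\<forall>i j. i < j \<longrightarrow> j < n \<longrightarrow> ({a i, a j} \<in> K \<longleftrightarrow> j = Suc i \<or> (i = 0 \<and> j = n - 1))))"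

text \<open>Cleanness of a clutter in terms of the family \<open>K\<close> of its covers. The two patterns are
  tested only in minors without small covers, where they make the minor an excluded clutter.\<close>

definition clean_covers :: "'a set \<Rightarrow> 'a set set \<Rightarrow> bool" where
  "clean_covers V K \<longleftrightarrow> finite V \<and> K \<subseteq> Pow V \<and> (\<forall>A B. A \<in> K \<longrightarrow> A \<subseteq> B \<longrightarrow> B \<subseteq> V \<longrightarrow> B \<in> K) \<and>
     (\<forall>Q R. Q \<subseteq> V \<longrightarrow> R \<subseteq> V \<longrightarrow> Q \<inter> R = {} \<longrightarrow> no_small (cover_minor K Q R) \<longrightarrow>
        \<not> delta_covers R (cover_minor K Q R) \<and> \<not> odd_hole_covers R (cover_minor K Q R))"

lemma clean_covers_finite: "clean_covers V K \<Longrightarrow> finite V"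
  and clean_covers_subset: "clean_covers V K \<Longrightarrow> A \<in> K \<Longrightarrow> A \<subseteq> V"
  and clean_covers_up: "clean_covers V K \<Longrightarrow> A \<in> K \<Longrightarrow> A \<subseteq> B \<Longrightarrow> B \<subseteq> V \<Longrightarrow> B \<in> K"
  by (auto simp: clean_covers_def)

text \<open>A minor of a minor is a minor.\<close>

lemma clean_covers_minor:
  assumes "clean_covers V K" "Q \<subseteq> V" "R \<subseteq> V" "Q \<inter> R = {}"
  shows "clean_covers R (cover_minor K Q R)"
proof -
  have comp: "cover_minor (cover_minor K Q R) Q' R' = cover_minor K (Q \<union> Q') R'"
    if "Q' \<subseteq> R" "R' \<subseteq> R" for Q' R'
    using that by (auto simp: cover_minor_def Un_ac)
  have "B \<in> cover_minor K Q R" if "A \<in> cover_minor K Q R" "A \<subseteq> B" "B \<subseteq> R" for A B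
    using that clean_covers_up[OF assms(1), of "A \<union> Q" "B \<union> Q"] assms(2,3)
    by (auto simp: cover_minor_def)
  moreover have "\<not> delta_covers R' (cover_minor K (Q \<union> Q') R') \<and> \<not> odd_hole_covers R' (cover_minor K (Q \<union> Q') R')"
    if "Q' \<subseteq> R" "R' \<subseteq> R" "Q' \<inter> R' = {}" "no_small (cover_minor K (Q \<union> Q') R')" for Q' R'
  proof -
    have "Q \<union> Q' \<subseteq> V" "R' \<subseteq> V" "(Q \<union> Q') \<inter> R' = {}" using that assms by auto
    then show ?thesis using assms(1) that(4) unfolding clean_covers_def by blast
  qed
  ultimately show ?thesis
    unfolding clean_covers_def
    using assms finite_subset[OF assms(3)] comp by (auto simp: cover_minor_def clean_covers_def)
qed

text \<open>The forbidden delta may be sought inside the given family: restricting to its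
  ground set creates no new members.\<close>

lemma clean_covers_not_delta:
  assumes "clean_covers V K" "no_small K" "t \<notin> X" "X \<in> K" "\<And>Y. Y \<in> K \<Longrightarrow> Y \<subseteq> X \<Longrightarrow> Y = X"
    "\<And>x. x \<in> X \<Longrightarrow> {t, x} \<in> K"
  shows False
proof -
  let ?R = "insert t X"
  let ?K = "cover_minor K {} ?R"
  have X: "X \<noteq> {}" using assms(2,4) by (auto simp: no_small_def)
  then have R: "?R \<subseteq> V" using assms(1,4,6) by (metis clean_covers_subset insert_subset ex_in_conv)
  have "no_small ?K" using assms(2) by (auto simp: no_small_def cover_minor_def)
  moreover have "delta_covers ?R ?K"
    unfolding delta_covers_def
    by (rule exI[of _ t], rule exI[of _ X]) (use assms in \<open>auto simp: cover_minor_def\<close>)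
  ultimately show False
    using assms(1) R unfolding clean_covers_def by blast
qed

section \<open>The graph of two-element covers\<close>

definition edges :: "'a set set \<Rightarrow> 'a rel" where
  "edges K = {(u, v). {u, v} \<in> K}"

lemma edges_sym: "(u, v) \<in> edges K \<Longrightarrow> (v, u) \<in> edges K"
  by (auto simp: edges_def insert_commute)

lemma relpow_edges_sym: "(u, v) \<in> edges K ^^ n \<Longrightarrow> (v, u) \<in> edges K ^^ n"
proof (induction n arbitrary: v)
  case (Suc n)
  then show ?case by (meson edges_sym relpow_Suc_E relpow_Suc_I2)
qed simp

lemma relpow_add_I: "(u, v) \<in> E ^^ m \<Longrightarrow> (v, w) \<in> E ^^ n \<Longrightarrow> (u, w) \<in> E ^^ (m + n)"
  by (auto simp: relpow_add)

lemma relpow_segment: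
  assumes "\<And>i. i < n \<Longrightarrow> (a i, a (Suc i)) \<in> E" "i \<le> j" "j \<le> n"
  shows "(a i, a j) \<in> E ^^ (j - i)"
  unfolding relpow_fun_conv
  by (rule exI[of _ "\<lambda>l. a (i + l)"]) (use assms in auto)

text \<open>A shortest odd closed walk visits no vertex twice and has no chord, as either would split it into
  two shorter closed walks, one of them odd. So it is a triangle, which is a delta, or an odd hole.\<close>

lemma no_odd_closed_walk:
  assumes cl: "clean_covers V K" and ns: "no_small K"
  shows "odd n \<Longrightarrow> (v, v) \<in> edges K ^^ n \<Longrightarrow> False"
proof (induction n arbitrary: v rule: less_induct)
  case (less n)
  let ?E = "edges K"
  obtain a where a0: "a 0 = v" "a n = v" and step: "\<And>i. i < n \<Longrightarrow> (a i, a (Suc i)) \<in> ?E"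
    using less.prems(2) by (auto simp: relpow_fun_conv)
  have seg: "(a i, a j) \<in> ?E ^^ (j - i)" if "i \<le> j" "j \<le> n" for i j
    using relpow_segment[of n a ?E i j] step that by blast
  have irr: "(u, u) \<notin> ?E" for u using ns by (auto simp: edges_def no_small_def)
  have "n \<noteq> 1" using less.prems irr by auto
  then have n3: "n \<ge> 3" using less.prems(1) by (metis One_nat_def Suc_leI dvd_refl less_one linorder_neqE_nat numeral_2_eq_2 numeral_3_eq_3 odd_pos order_le_less)
  \<comment> \<open>The remaining arc, running from \<open>a j\<close> through \<open>a n = a 0\<close> to \<open>a i\<close>.\<close>
  have tail: "(a j, a i) \<in> ?E ^^ (n - (j - i))" if "i \<le> j" "j \<le> n" for i j
  proof -
    have "(a j, a n) \<in> ?E ^^ (n - j)" "(a 0, a i) \<in> ?E ^^ i"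
      using seg[of j n] seg[of 0 i] that by auto
    then have "(a j, a i) \<in> ?E ^^ (n - j + i)" using a0 relpow_add_I by metis
    then show ?thesis using that by simp
  qed
  have inj: "inj_on a {..<n}"
  proof (rule linorder_inj_onI)
    fix i j assume ij: "i < j" "i \<in> {..<n}" "j \<in> {..<n}"
    show "a i \<noteq> a j"
    proof
      assume e: "a i = a j"
      have "(a i, a i) \<in> ?E ^^ (j - i)" using seg[of i j] ij e by auto
      moreover have "(a i, a i) \<in> ?E ^^ (n - (j - i))" using tail[of i j] ij e by auto
      moreover have "odd (j - i) \<or> odd (n - (j - i))" using less.prems(1) ij by auto
      moreover have "j - i < n" "n - (j - i) < n" using ij by auto
      ultimately show False using less.IH by blast
    qed
  qed auto
  have chord: "j = Suc i \<or> (i = 0 \<and> j = n - 1)" if ij: "i < j" "j < n" and e: "{a i, a j} \<in> K" for i j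
  proof (rule ccontr)
    assume c: "\<not> ?thesis"
    have e': "(a j, a i) \<in> ?E ^^ 1" "(a i, a j) \<in> ?E ^^ 1" using e by (auto simp: edges_def insert_commute)
    have "(a i, a i) \<in> ?E ^^ (j - i + 1)" using seg[of i j] ij e' relpow_add_I
      by (metis less_imp_le)
    moreover have "(a j, a j) \<in> ?E ^^ (n - (j - i) + 1)" using tail[of i j] ij e' relpow_add_I
      by (metis less_imp_le)
    moreover have "odd (j - i + 1) \<or> odd (n - (j - i) + 1)" using less.prems(1) ij by auto
    moreover have "j - i + 1 < n" "n - (j - i) + 1 < n" using ij c by auto
    ultimately show False using less.IH by blast
  qed
  have pair: "{a i, a (Suc i)} \<in> K" if "i < n" for i using step[OF that] by (simp add: edges_def)
  have last: "{a 0, a (n - 1)} \<in> K" using pair[of "n - 1"] n3 a0 by (simp add: insert_commute)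
  let ?R = "a ` {..<n}"
  have R: "?R \<subseteq> V" using pair clean_covers_subset[OF cl] by fastforce
  have nsR: "no_small (cover_minor K {} ?R)" using ns by (auto simp: no_small_def cover_minor_def)
  show False
  proof (cases "n = 3")
    case True
    show False
    proof (rule clean_covers_not_delta[OF cl ns, of "a 0" "{a 1, a 2}"])
      show "a 0 \<notin> {a 1, a 2}" using inj_onD[OF inj, of 0 1] inj_onD[OF inj, of 0 2] True by auto
      show "{a 1, a 2} \<in> K" using pair[of 1] True by (simp add: numeral_2_eq_2)
      show "{a 0, x} \<in> K" if "x \<in> {a 1, a 2}" for x
        using that pair[of 0] last True by (auto simp: numeral_2_eq_2)
      fix Y assume Y: "Y \<in> K" "Y \<subseteq> {a 1, a 2}"
      have "Y \<noteq> {}" "Y \<noteq> {a 1}" "Y \<noteq> {a 2}" using Y(1) ns by (auto simp: no_small_def)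
      then show "Y = {a 1, a 2}" using Y(2) by blast
    qed
  next
    case False
    then have "n \<ge> 5" using n3 less.prems(1) by (cases "n = 4") auto
    moreover have "bij_betw a {..<n} ?R" using inj by (simp add: bij_betw_def)
    moreover have "{a i, a j} \<in> cover_minor K {} ?R \<longleftrightarrow> j = Suc i \<or> (i = 0 \<and> j = n - 1)"
      if "i < j" "j < n" for i j
      using chord[OF that] pair[of i] last that by (auto simp: cover_minor_def)
    ultimately have "odd_hole_covers ?R (cover_minor K {} ?R)"
      unfolding odd_hole_covers_def using less.prems(1) by blast
    then show False using cl R nsR unfolding clean_covers_def by blast
  qed
qed

text \<open>Induction on the length of the walk from \<open>p 0\<close> to \<open>p (2 * m)\<close>. If the walk meets \<open>X\<close> in between, it
  can be cut. Otherwise take a largest part \<open>Q\<close> of \<open>X\<close> outside the walk for which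
  \<open>cover_minor K Q R\<close>, with \<open>R\<close> the walk and \<open>X - Q\<close>, has no singletons. By maximality every element of
  \<open>X - Q\<close> off the walk becomes adjacent to a vertex of the walk; the minimality of \<open>X\<close> puts that vertex
  outside \<open>W\<close>. If there is no such element, then \<open>X - Q\<close> is an edge that closes the walk to an odd
  cycle. If the walk has length two, its middle vertex is adjacent to all of \<open>X - Q\<close>, which is a
  delta. In the remaining case the new edge yields a shorter walk in the minor.\<close>

lemma no_member_joined_by_alternating_walk:
  assumes "clean_covers V K" "no_small K"
    "X \<in> K" "X \<subseteq> W" "\<And>Y. Y \<in> K \<Longrightarrow> Y \<subseteq> W \<Longrightarrow> card X \<le> card Y"
    "p 0 \<in> X" "p (2 * m) \<in> X" "p 0 \<noteq> p (2 * m)"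
    "\<And>i. i < 2 * m \<Longrightarrow> (p i, p (Suc i)) \<in> edges K"
    "\<And>i. i \<le> 2 * m \<Longrightarrow> p i \<in> W \<longleftrightarrow> even i"
  shows False
  using assms
proof (induction m arbitrary: V K X p rule: less_induct)
  case (less m)
  note cl = less.prems(1) and ns = less.prems(2) and XK = less.prems(3) and XW = less.prems(4)
    and mini = less.prems(5) and ends = less.prems(6-8) and side = less.prems(10)
  have seg: "\<And>i. i < 2 * m \<Longrightarrow> (p i, p (Suc i)) \<in> edges K" by (rule less.prems(9))
  have XV: "X \<subseteq> V" and finX: "finite X"
    using clean_covers_subset[OF cl XK] clean_covers_finite[OF cl] finite_subset by auto
  have m0: "m > 0" using ends(3) by (cases m) auto
  show False
  proof (cases "\<exists>i. 0 < i \<and> i < m \<and> p (2 * i) \<in> X")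
    case True
    then obtain i where i: "0 < i" "i < m" "p (2 * i) \<in> X" by blast
    show False
    proof (cases "p (2 * i) = p 0")
      case False
      show False
        by (rule less.IH[of i V K X p]) (use less.prems i False in auto)
    next
      case True
      show False
        by (rule less.IH[of "m - i" V K X "\<lambda>l. p (2 * i + l)"])
          (use less.prems i True in \<open>auto simp: diff_mult_distrib2\<close>)
    qed
  next
    case False
    define P where "P = p ` {..2 * m}"
    have PX: "x = p 0 \<or> x = p (2 * m)" if xP: "x \<in> P" "x \<in> X" for x
    proof -
      obtain i where i: "x = p i" "i \<le> 2 * m" using xP by (auto simp: P_def)
      then have "even i" using side xP XW by blast
      then obtain l where "i = 2 * l" by (elim evenE)
      then show ?thesis using False i xP by (metis bot_nat_0.not_eq_extremum le_neq_implies_less mult_0_right mult_le_cancel1 zero_less_numeral)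
    qed
    have PV: "P \<subseteq> V"
    proof
      fix x assume "x \<in> P"
      then obtain i where i: "x = p i" "i \<le> 2 * m" by (auto simp: P_def)
      show "x \<in> V"
      proof (cases "i < 2 * m")
        case True
        then show ?thesis using seg[of i] i clean_covers_subset[OF cl] by (fastforce simp: edges_def)
      next
        case False
        then show ?thesis using i ends XV by auto
      qed
    qed
    define F where "F = {Q. Q \<subseteq> X - P \<and> (\<forall>s\<in>P. insert s Q \<notin> K)}"
    have "finite F" using finX by (auto simp: F_def intro: finite_subset[of _ "Pow X"])
    moreover have "{} \<in> F" using ns by (auto simp: no_small_def F_def)
    ultimately obtain Q where QF: "Q \<in> F" and Qmax: "\<And>Q'. Q' \<in> F \<Longrightarrow> Q \<subseteq> Q' \<Longrightarrow> Q = Q'"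
      using finite_has_maximal[of F] by (metis empty_iff)
    have Q: "Q \<subseteq> X - P" "\<And>s. s \<in> P \<Longrightarrow> insert s Q \<notin> K" using QF by (auto simp: F_def)
    have endP: "p 0 \<in> P" "p (2 * m) \<in> P" by (auto simp: P_def)
    have finQ: "finite Q" using Q finX finite_subset by blast
    define R where "R = P \<union> (X - Q)"
    define K' where "K' = cover_minor K Q R"
    have RV: "R \<subseteq> V" "Q \<subseteq> V" "Q \<inter> R = {}" using PV XV Q by (auto simp: R_def)
    have cl': "clean_covers R K'" unfolding K'_def by (rule clean_covers_minor[OF cl RV(2,1,3)])
    \<comment> \<open>\<open>X\<close> has the smallest cardinality. This excludes singletons of the minor off the walk.\<close>
    have proper: "Y \<notin> K" if "Y \<subset> X" for Y
      using that mini[of Y] psubset_card_mono[OF finX that] XW by force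
    have ns': "no_small K'"
    proof -
      have "{} \<union> Q \<notin> K" using proper[of Q] Q ends endP by auto
      moreover have "{s} \<union> Q \<notin> K" if "s \<in> R" for s
      proof (cases "s \<in> P")
        case False
        then have "insert s Q \<subset> X" using that Q ends endP by (auto simp: R_def)
        then show ?thesis using proper by simp
      qed (use Q in auto)
      ultimately show ?thesis by (auto simp: no_small_def K'_def cover_minor_def)
    qed
    have X'K: "X - Q \<in> K'" using XK Q(1) by (auto simp: K'_def cover_minor_def R_def Un_absorb2 dest: subset_trans[OF _ Diff_subset])
    have mini': "card (X - Q) \<le> card Y" if "Y \<in> K'" "Y \<subseteq> W" for Y
    proof -
      have "card X \<le> card (Y \<union> Q)" using mini[of "Y \<union> Q"] that Q XW by (auto simp: K'_def cover_minor_def)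
      also have "\<dots> \<le> card Y + card Q" by (rule card_Un_le)
      finally have "card X \<le> card Y + card Q" .
      moreover have "card (X - Q) = card X - card Q"
        by (rule card_Diff_subset[OF finQ]) (use Q(1) in blast)
      ultimately show ?thesis by linarith
    qed
    have edge': "{u, v} \<in> K'" if "{u, v} \<in> K" "u \<in> P" "v \<in> P" for u v
      using clean_covers_up[OF cl that(1), of "{u, v} \<union> Q"] that PV RV by (auto simp: K'_def cover_minor_def R_def)
    have seg': "(p i, p (Suc i)) \<in> edges K'" if "i < 2 * m" for i
      using seg[OF that] that by (auto simp: edges_def P_def intro!: edge')
    have attach: "\<exists>j < 2 * m. odd j \<and> {p j, x} \<in> K'" if x: "x \<in> X - Q" "x \<notin> P" for x
    proof -
      have "insert x Q \<notin> F" using Qmax[of "insert x Q"] x by blast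
      then obtain j where j: "j \<le> 2 * m" "insert (p j) (insert x Q) \<in> K" using Q x by (auto simp: P_def F_def)
      have "odd j"
      proof
        assume "even j"
        then have "card X \<le> card (insert (p j) (insert x Q))"
          using mini[OF j(2)] side[OF j(1)] x Q XW by auto
        also have "\<dots> \<le> card Q + 2" using finQ by (metis add_2_eq_Suc' card_insert_le_m1 card_insert_if le_SucI finite_insert le_refl Suc_le_mono)
        finally have "card X \<le> card Q + 2" .
        \<comment> \<open>Besides \<open>Q\<close>, \<open>X\<close> contains \<open>x\<close> and both ends of the walk.\<close>
        moreover have "card ({x, p 0, p (2 * m)} \<union> Q) \<le> card X"
          by (rule card_mono) (use finX x ends Q in auto)
        moreover have "x \<noteq> p 0" "x \<noteq> p (2 * m)" using x endP by auto
        then have "card {x, p 0, p (2 * m)} = 3" using ends(3) by simp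
        then have "card ({x, p 0, p (2 * m)} \<union> Q) = 3 + card Q"
          by (subst card_Un_disjoint) (use finQ x ends endP Q in auto)
        ultimately show False by simp
      qed
      moreover have "{p j, x} \<in> K'" using j x by (auto simp: K'_def cover_minor_def R_def P_def)
      moreover have "j < 2 * m" using \<open>odd j\<close> j by (metis dvd_triv_left le_neq_implies_less)
      ultimately show ?thesis by blast
    qed
    consider "X - Q = {p 0, p (2 * m)}" | "m = 1" | x where "m \<ge> 2" "x \<in> X - Q" "x \<notin> P"
      using PX ends endP Q m0 by (cases "m = 1") auto
    then show False
    proof cases
      case 1
      have "(p 0, p (2 * m)) \<in> edges K' ^^ (2 * m)" 
        using relpow_segment[of "2 * m" p "edges K'" 0 "2 * m"] seg' by auto
      moreover have "(p (2 * m), p 0) \<in> edges K' ^^ 1" using X'K 1 by (simp add: edges_def insert_commute)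
      ultimately have "(p 0, p 0) \<in> edges K' ^^ (2 * m + 1)" by (rule relpow_add_I)
      then show False using no_odd_closed_walk[OF cl' ns', of "2 * m + 1"] by simp
    next
      case 2
      have "{p 1, x} \<in> K'" if xX: "x \<in> X - Q" for x
      proof (cases "x \<in> P")
        case True
        then have "x = p 0 \<or> x = p 2" using PX xX 2 by auto
        then show ?thesis using seg'[of 0] seg'[of 1] 2 by (auto simp: edges_def insert_commute numeral_2_eq_2)
      next
        case False
        then obtain j where "j < 2" "odd j" "{p j, x} \<in> K'" using attach[of x] xX 2 by auto
        moreover from this have "j = 1" by (metis One_nat_def even_zero less_2_cases)
        ultimately show ?thesis by simp
      qed
      moreover have "p 1 \<notin> X - Q" using side[of 1] 2 XW by auto
      moreover have "Y = X - Q" if "Y \<in> K'" "Y \<subseteq> X - Q" for Y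
        using card_seteq[of "X - Q" Y] that mini'[of Y] finX XW by auto
      ultimately show False using clean_covers_not_delta[OF cl' ns' _ X'K] by blast
    next
      case 3
      then obtain j where j: "j < 2 * m" "odd j" "{p j, x} \<in> K'" using attach[of x] by auto
      have xp: "x \<noteq> p 0" "x \<noteq> p (2 * m)" using 3 endP by auto
      have ends': "p 0 \<in> X - Q" "p (2 * m) \<in> X - Q" using ends Q endP by auto
      have X'W: "X - Q \<subseteq> W" using XW by auto
      have jx: "(p j, x) \<in> edges K'" "(x, p j) \<in> edges K'" using j by (auto simp: edges_def insert_commute)
      show False
      proof (cases "j = 1")
        case True
        \<comment> \<open>The walk \<open>p 0, p 1, x\<close> has length 2, less than \<open>2 * m\<close>.\<close>
        define q where "q = (\<lambda>i::nat. if i = 0 then p 0 else if i = 1 then p 1 else x)"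
        show False
        proof (rule less.IH[of 1 R K' "X - Q" q, OF _ cl' ns' X'K X'W])
          show "(q i, q (Suc i)) \<in> edges K'" if "i < 2 * 1" for i
            using that seg'[of 0] jx True 3 by (auto simp: q_def)
          show "(q i \<in> W) = even i" if "i \<le> 2 * 1" for i
          proof -
            have "i = 0 \<or> i = 1 \<or> i = 2" using that by auto
            then show ?thesis using side[of 0] side[of 1] 3 XW by (auto simp: q_def)
          qed
        qed (use 3 mini' ends' xp in \<open>auto simp: q_def\<close>)
      next
        case False
        then have j1: "j > 1" using j(2) by (metis even_zero less_one linorder_neqE_nat)
        \<comment> \<open>From \<open>x\<close> along the rest of the walk \<open>p j, \<dots>, p (2 * m)\<close>; as \<open>j \<ge> 3\<close>, this is shorter.\<close>
        define q where "q = (\<lambda>i::nat. if i = 0 then x else p (j + i - 1))"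
        obtain l where l: "j = 2 * l + 1" using j(2) by (elim oddE)
        show False
        proof (rule less.IH[of "m - l" R K' "X - Q" q, OF _ cl' ns' X'K X'W])
          show "(q i, q (Suc i)) \<in> edges K'" if "i < 2 * (m - l)" for i
          proof (cases "i = 0")
            case False
            then have "Suc (j + i - 1) = j + Suc i - 1" "j + i - 1 < 2 * m" using that l by auto
            then show ?thesis using seg'[of "j + i - 1"] False by (simp add: q_def)
          qed (use jx in \<open>simp add: q_def\<close>)
          show "(q i \<in> W) = even i" if "i \<le> 2 * (m - l)" for i
            using that side[of "j + i - 1"] l 3 XW by (auto simp: q_def)
          show "m - l < m" using j1 l m0 by simp
        qed (use 3 mini' ends' xp l j1 j in \<open>auto simp: q_def diff_mult_distrib2\<close>)
      qed
    qed
  qed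
qed

text \<open>In a bipartite graph the vertices at even and at odd distance from \<open>v\<close> are the two colour
  classes of the component of \<open>v\<close>; walks are used in place of distances.\<close>

definition same_side :: "'a set set \<Rightarrow> 'a \<Rightarrow> 'a set" where
  "same_side K v = {u. \<exists>n. even n \<and> (v, u) \<in> edges K ^^ n}"

definition other_side :: "'a set set \<Rightarrow> 'a \<Rightarrow> 'a set" where
  "other_side K v = {u. \<exists>n. odd n \<and> (v, u) \<in> edges K ^^ n}"

lemma side_member: "v \<in> same_side K v"
  unfolding same_side_def by (auto intro!: exI[of _ 0])

lemma sides_component: "same_side K v \<union> other_side K v = (edges K)\<^sup>* `` {v}"
  by (simp add: set_eq_iff same_side_def other_side_def rtrancl_power) blast

lemma sides_neighbour:
  assumes "(v, w) \<in> edges K"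
  shows "same_side K w = other_side K v" "other_side K w = same_side K v"
proof -
  have wv: "(w, v) \<in> edges K ^^ 1" and vw: "(v, w) \<in> edges K ^^ 1"
    using assms edges_sym[OF assms] by auto
  have 1: "(w, u) \<in> edges K ^^ (1 + n)" if "(v, u) \<in> edges K ^^ n" for u n
    by (rule relpow_add_I[OF wv that])
  have 2: "(v, u) \<in> edges K ^^ (1 + n)" if "(w, u) \<in> edges K ^^ n" for u n
    by (rule relpow_add_I[OF vw that])
  have odd: "odd n \<Longrightarrow> even (1 + n)" "even n \<Longrightarrow> odd (1 + n)" for n :: nat by auto
  have "(\<exists>n. even n \<and> (w, u) \<in> edges K ^^ n) \<longleftrightarrow> (\<exists>n. odd n \<and> (v, u) \<in> edges K ^^ n)"
    "(\<exists>n. odd n \<and> (w, u) \<in> edges K ^^ n) \<longleftrightarrow> (\<exists>n. even n \<and> (v, u) \<in> edges K ^^ n)" for u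
    using 1[where u = u] 2[where u = u] odd by metis+
  then show "same_side K w = other_side K v" "other_side K w = same_side K v"
    by (simp_all add: same_side_def other_side_def)
qed

lemma sides_disjoint:
  assumes "clean_covers V K" "no_small K"
  shows "same_side K v \<inter> other_side K v = {}"
proof (rule ccontr)
  assume "same_side K v \<inter> other_side K v \<noteq> {}"
  then obtain u m n where "even m" "(v, u) \<in> edges K ^^ m" "odd n" "(v, u) \<in> edges K ^^ n"
    by (auto simp: same_side_def other_side_def)
  then have "(v, v) \<in> edges K ^^ (m + n)" "odd (m + n)"
    using relpow_add_I relpow_edges_sym by (metis, simp)
  then show False using no_odd_closed_walk[OF assms] by blast
qed

lemma edges_subset: "clean_covers V K \<Longrightarrow> (u, v) \<in> edges K \<Longrightarrow> u \<in> V \<and> v \<in> V"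
  using clean_covers_subset by (fastforce simp: edges_def)

lemma component_subset:
  assumes "clean_covers V K" "v \<in> V"
  shows "(edges K)\<^sup>* `` {v} \<subseteq> V"
proof -
  have "u \<in> V" if "(v, u) \<in> (edges K)\<^sup>*" for u
    using that by induction (use assms(2) edges_subset[OF assms(1)] in blast)+
  then show ?thesis by auto
qed

text \<open>A smallest member inside the colour class contains two elements joined by an alternating
  walk.\<close>

lemma no_member_in_side:
  assumes cl: "clean_covers V K" and ns: "no_small K" and "X \<in> K" "X \<subseteq> same_side K v"
  shows False
proof -
  let ?W = "same_side K v"
  let ?E = "edges K"
  obtain X where X: "X \<in> K" "X \<subseteq> ?W" and mini: "\<And>Y. Y \<in> K \<Longrightarrow> Y \<subseteq> ?W \<Longrightarrow> card X \<le> card Y"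
    using ex_has_least_nat[of "\<lambda>Y. Y \<in> K \<and> Y \<subseteq> ?W" X card] assms(3,4) by metis
  have "X \<noteq> {}" and not_single: "X \<noteq> {x}" for x using X(1) ns unfolding no_small_def by metis+
  then obtain x where x: "x \<in> X" by blast
  have "X \<noteq> {x}" by (rule not_single)
  then obtain y where y: "y \<in> X" "y \<noteq> x" using x by blast
  have "\<exists>m. even m \<and> (v, u) \<in> ?E ^^ m" if "u \<in> X" for u
    using subsetD[OF X(2) that] by (simp add: same_side_def)
  then obtain m n where mn: "even m" "(v, x) \<in> ?E ^^ m" "even n" "(v, y) \<in> ?E ^^ n"
    using x y(1) by metis
  have "(x, y) \<in> ?E ^^ (m + n)" using relpow_add_I[OF relpow_edges_sym[OF mn(2)] mn(4)] .
  moreover obtain l where l: "m + n = 2 * l" using mn by (metis even_add evenE)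
  ultimately obtain p where p: "p 0 = x" "p (2 * l) = y" "\<And>i. i < 2 * l \<Longrightarrow> (p i, p (Suc i)) \<in> ?E"
    by (auto simp: relpow_fun_conv)
  have "p i \<in> ?W \<longleftrightarrow> even i" if "i \<le> 2 * l" for i
  proof -
    have "(x, p i) \<in> ?E ^^ i" using relpow_segment[of "2 * l" p ?E 0 i] p that by auto
    then have w: "(v, p i) \<in> ?E ^^ (m + i)" using mn relpow_add_I by metis
    show ?thesis
    proof (cases "even i")
      case True
      then have "even (m + i)" using mn by simp
      then show ?thesis using w True unfolding same_side_def by blast
    next
      case False
      then have "odd (m + i)" using mn by simp
      then have "p i \<in> other_side K v" using w unfolding other_side_def by blast
      then show ?thesis using False sides_disjoint[OF cl ns, of v] by blast
    qed
  qed
  then show False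
    using no_member_joined_by_alternating_walk[OF cl ns X mini, of p l] p x y by auto
qed

text \<open>Contracting \<open>z\<close> in the family, and restricting to the component of \<open>v\<close>, reduces this to the
  previous lemma: no singleton \<open>{b}\<close> arises, because \<open>{b, z}\<close> would be an edge leaving the component.\<close>

lemma no_member_in_side_insert:
  assumes cl: "clean_covers V K" and ns: "no_small K" and X: "X \<in> K" "X \<subseteq> insert z (same_side K v)"
    and v: "v \<in> V" and z: "(v, z) \<notin> (edges K)\<^sup>*"
  shows False
proof -
  let ?R = "(edges K)\<^sup>* `` {v}"
  let ?K = "cover_minor K {z} ?R"
  have RV: "?R \<subseteq> V" by (rule component_subset[OF cl v])
  have "z \<in> X" using no_member_in_side[OF cl ns X(1)] X(2) by blast
  then have zV: "z \<in> V" using clean_covers_subset[OF cl X(1)] by blast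
  have cl': "clean_covers ?R ?K"
    by (rule clean_covers_minor[OF cl]) (use RV z zV in auto)
  have "{b, z} \<notin> K" if "(v, b) \<in> (edges K)\<^sup>*" for b
    using z rtrancl_into_rtrancl[OF that, of z] by (auto simp: edges_def)
  moreover have "{z} \<notin> K" using ns unfolding no_small_def by blast
  ultimately have ns': "no_small ?K"
    unfolding no_small_def cover_minor_def mem_Collect_eq Un_insert_left sup_bot_left by blast
  have "(v, u) \<in> edges ?K ^^ n" if "(v, u) \<in> edges K ^^ n" for u n
    using that
  proof (induction n arbitrary: u)
    case (Suc n)
    then obtain t where t: "(v, t) \<in> edges K ^^ n" "(t, u) \<in> edges K" by auto
    then have tu: "t \<in> ?R" "u \<in> ?R" using rtrancl_power rtrancl_into_rtrancl by (metis Image_singleton_iff)+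
    have "{t, u} \<union> {z} \<in> K"
      by (rule clean_covers_up[OF cl, of "{t, u}"]) (use t tu RV zV in \<open>auto simp: edges_def\<close>)
    then have "(t, u) \<in> edges ?K" using tu by (auto simp: edges_def cover_minor_def)
    then show ?case using Suc.IH[OF t(1)] by auto
  qed simp
  then have "same_side K v \<subseteq> same_side ?K v" unfolding same_side_def by blast
  moreover have "X - {z} \<in> ?K"
    using X \<open>z \<in> X\<close> sides_component[of K v] by (auto simp: cover_minor_def insert_absorb)
  ultimately show False
    using no_member_in_side[OF cl' ns', of "X - {z}" v] X(2) by blast
qed

section \<open>Means over a finite set\<close>

text \<open>Probability distributions on \<open>T\<close> are represented by their expectation functionals, which makes
  averaging and passing to images short.\<close>

definition is_mean :: "'b set \<Rightarrow> (('b \<Rightarrow> real) \<Rightarrow> real) \<Rightarrow> bool" where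
  "is_mean T L \<longleftrightarrow> (\<exists>y. (\<forall>M\<in>T. 0 \<le> y M) \<and> sum y T = 1 \<and> (\<forall>g. L g = (\<Sum>M\<in>T. y M * g M)))"

lemma mean_cong: "is_mean T L \<Longrightarrow> (\<And>M. M \<in> T \<Longrightarrow> g M = h M) \<Longrightarrow> L g = L h"
  by (auto simp: is_mean_def intro!: sum.cong)

lemma mean_scale: "is_mean T L \<Longrightarrow> L (\<lambda>M. c * g M) = c * L g"
  by (auto simp: is_mean_def sum_distrib_left mult_ac)

lemma mean_const: "is_mean T L \<Longrightarrow> (\<And>M. M \<in> T \<Longrightarrow> g M = c) \<Longrightarrow> L g = c"
proof -
  assume L: "is_mean T L" and g: "\<And>M. M \<in> T \<Longrightarrow> g M = c"
  obtain y where y: "sum y T = 1" "\<And>g. L g = (\<Sum>M\<in>T. y M * g M)" using L by (auto simp: is_mean_def)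
  have "L g = (\<Sum>M\<in>T. y M * c)" unfolding y(2) by (rule sum.cong) (use g in auto)
  also have "\<dots> = c" using y(1) by (simp flip: sum_distrib_right)
  finally show ?thesis .
qed

lemma mean_map:
  assumes "is_mean T L" "finite T" "finite T'" "h ` T \<subseteq> T'"
  shows "is_mean T' (\<lambda>g. L (\<lambda>M. g (h M)))"
proof -
  obtain y where y: "\<forall>M\<in>T. 0 \<le> y M" "sum y T = 1" "\<And>g. L g = (\<Sum>M\<in>T. y M * g M)"
    using assms(1) by (auto simp: is_mean_def)
  let ?y = "\<lambda>N. \<Sum>M\<in>{M \<in> T. h M = N}. y M"
  have "(\<Sum>N\<in>T'. ?y N * g N) = (\<Sum>M\<in>T. y M * g (h M))" for g
  proof -
    have "(\<Sum>N\<in>T'. ?y N * g N) = (\<Sum>N\<in>T'. \<Sum>M\<in>{M \<in> T. h M = N}. y M * g (h M))"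
      by (auto simp: sum_distrib_right intro!: sum.cong)
    also have "\<dots> = (\<Sum>M\<in>T. y M * g (h M))"
      by (rule sum.group) (use assms in auto)
    finally show ?thesis .
  qed
  moreover from this[of "\<lambda>_. 1"] have "sum ?y T' = 1" using y(2) by simp
  moreover have "\<forall>N\<in>T'. 0 \<le> ?y N" using y(1) by (auto intro!: sum_nonneg)
  ultimately show ?thesis unfolding is_mean_def y(3) by (intro exI[of _ ?y]) auto
qed

lemma mean_mix:
  assumes "is_mean S L" "is_mean T L'" "S \<subseteq> A" "T \<subseteq> A" "finite A"
  shows "is_mean A (\<lambda>g. (L g + L' g) / 2)"
proof -
  have fin: "finite S" "finite T" using assms finite_subset by auto
  have "is_mean A L" "is_mean A L'"
    using mean_map[OF assms(1) fin(1) assms(5), of "\<lambda>M. M"] mean_map[OF assms(2) fin(2) assms(5), of "\<lambda>M. M"] assms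
    by auto
  then obtain y y' where y: "\<forall>M\<in>A. 0 \<le> y M" "sum y A = 1" "\<And>g. L g = (\<Sum>M\<in>A. y M * g M)"
     "\<forall>M\<in>A. 0 \<le> y' M" "sum y' A = 1" "\<And>g. L' g = (\<Sum>M\<in>A. y' M * g M)"
    unfolding is_mean_def by metis
  let ?z = "\<lambda>M. (y M + y' M) / 2"
  have "sum ?z A = 1" using y(2,5) by (simp flip: sum_divide_distrib add: sum.distrib)
  moreover have "(L g + L' g) / 2 = (\<Sum>M\<in>A. ?z M * g M)" for g
    unfolding y(3,6) sum.distrib[symmetric] sum_divide_distrib
    by (rule sum.cong) (auto simp: field_simps)
  moreover have "\<forall>M\<in>A. 0 \<le> ?z M" using y by auto
  ultimately show ?thesis unfolding is_mean_def by (intro exI[of _ ?z]) auto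
qed

section \<open>Transversals and conditioning on a component\<close>

text \<open>The sets \<open>M\<close> that intersect every member of \<open>K\<close> and contain exactly one end of each edge. If \<open>K\<close> is the
  family of covers of a tangled clutter, these turn out to be members of the clutter
  (\<open>transversals_subset_clutter\<close>).\<close>

definition transversals :: "'a set \<Rightarrow> 'a set set \<Rightarrow> 'a set set" where
  "transversals V K = {M. M \<subseteq> V \<and> V - M \<notin> K \<and> (\<forall>u v. (u, v) \<in> edges K \<longrightarrow> (u \<in> M \<longleftrightarrow> v \<notin> M))}"

definition mem_sign :: "'a \<Rightarrow> 'a set \<Rightarrow> real" where
  "mem_sign v M = (if v \<in> M then 1 else -1)"

lemma mem_sign_walk:
  "M \<in> transversals V K \<Longrightarrow> (u, v) \<in> edges K ^^ n \<Longrightarrow> mem_sign v M = (-1) ^ n * mem_sign u M"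
proof (induction n arbitrary: v)
  case (Suc n)
  then obtain t where t: "(u, t) \<in> edges K ^^ n" "(t, v) \<in> edges K" by auto
  then have "mem_sign v M = - mem_sign t M" using Suc.prems by (auto simp: transversals_def mem_sign_def)
  then show ?case using Suc t by simp
qed simp

lemma finite_transversals: "finite V \<Longrightarrow> finite (transversals V K)"
  by (rule finite_subset[of _ "Pow V"]) (auto simp: transversals_def)

definition tangled_covers :: "'a set \<Rightarrow> 'a set set \<Rightarrow> bool" where
  "tangled_covers V K \<longleftrightarrow> clean_covers V K \<and> no_small K \<and> (\<forall>v\<in>V. \<exists>u. (v, u) \<in> edges K)"

lemma tangled_neighbour:
  assumes "tangled_covers V K" "v \<in> V"
  obtains w where "(v, w) \<in> edges K" "w \<in> V"
proof -
  have cl: "clean_covers V K" and nb: "\<forall>v\<in>V. \<exists>u. (v, u) \<in> edges K"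
    using assms(1) by (auto simp: tangled_covers_def)
  obtain w where "(v, w) \<in> edges K" using nb assms(2) by blast
  with that edges_subset[OF cl this] show thesis by blast
qed

definition off_component :: "'a set \<Rightarrow> 'a set set \<Rightarrow> 'a \<Rightarrow> 'a set" where
  "off_component V K v = V - (edges K)\<^sup>* `` {v}"

text \<open>The minor of the clutter in which the colour class of \<open>v\<close> is deleted and the opposite class is
  contracted; it corresponds to the transversals avoiding \<open>v\<close>.\<close>

definition side_minor :: "'a set \<Rightarrow> 'a set set \<Rightarrow> 'a \<Rightarrow> 'a set set" where
  "side_minor V K v = cover_minor K (same_side K v) (off_component V K v)"

text \<open>A member of size at most one in the minor would give a member of \<open>K\<close> inside a
  colour class and at most one element outside the component. Edges off the component survive, so every
  remaining element keeps a neighbour.\<close>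

lemma tangled_side_minor:
  assumes T: "tangled_covers V K" and v: "v \<in> V"
  shows "tangled_covers (off_component V K v) (side_minor V K v)"
    and "M \<in> transversals (off_component V K v) (side_minor V K v) \<Longrightarrow> M \<union> other_side K v \<in> transversals V K"
proof -
  let ?R = "off_component V K v" and ?K = "side_minor V K v" and ?E = "edges K"
  let ?S = "same_side K v" and ?O = "other_side K v"
  have cl: "clean_covers V K" and ns: "no_small K" and nb: "\<And>v. v \<in> V \<Longrightarrow> \<exists>u. (v, u) \<in> ?E"
    using T by (auto simp: tangled_covers_def)
  have comp: "?S \<union> ?O = ?E\<^sup>* `` {v}" by (rule sides_component)
  have SV: "?S \<subseteq> V" "?O \<subseteq> V" using component_subset[OF cl v] comp by auto
  have R: "?R = V - ?S - ?O" unfolding off_component_def using comp by auto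
  have dis: "?S \<inter> ?O = {}" by (rule sides_disjoint[OF cl ns])
  have cl': "clean_covers ?R ?K"
    unfolding side_minor_def by (rule clean_covers_minor[OF cl SV(1)]) (use R in auto)
  have "{} \<union> ?S \<notin> K" using no_member_in_side[OF cl ns, of ?S v] by auto
  moreover have "{z} \<union> ?S \<notin> K" if "z \<in> ?R" for z
    using no_member_in_side_insert[OF cl ns, of "{z} \<union> ?S" z v] v that by (auto simp: off_component_def)
  ultimately have ns': "no_small ?K" by (auto simp: no_small_def side_minor_def cover_minor_def)
  have sep: "w \<in> ?R" if "u \<in> ?R" "(u, w) \<in> ?E" for u w
  proof -
    have "w \<in> V" using edges_subset[OF cl that(2)] by simp
    moreover have "(v, w) \<notin> ?E\<^sup>*"
      using that edges_sym[OF that(2)] by (auto simp: off_component_def intro: rtrancl_into_rtrancl)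
    ultimately show ?thesis by (simp add: off_component_def)
  qed
  have keep: "(u, w) \<in> edges ?K" if "u \<in> ?R" "(u, w) \<in> ?E" for u w
  proof -
    have "{u, w} \<union> ?S \<in> K"
      by (rule clean_covers_up[OF cl, of "{u, w}"])
        (use that sep[OF that] SV R in \<open>auto simp: edges_def\<close>)
    then show ?thesis using that sep[OF that] by (auto simp: edges_def side_minor_def cover_minor_def)
  qed
  show "tangled_covers ?R ?K"
    unfolding tangled_covers_def
  proof (intro conjI ballI cl' ns')
    fix u assume u: "u \<in> ?R"
    then obtain w where "(u, w) \<in> ?E" using nb[of u] R by blast
    then show "\<exists>w. (u, w) \<in> edges ?K" using keep[OF u] by blast
  qed
  assume M: "M \<in> transversals ?R ?K"
  have "V - (M \<union> ?O) = (?R - M) \<union> ?S" using M R SV dis by (auto simp: transversals_def)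
  then have "V - (M \<union> ?O) \<notin> K" using M by (auto simp: transversals_def side_minor_def cover_minor_def)
  moreover have "u \<in> M \<union> ?O \<longleftrightarrow> w \<notin> M \<union> ?O" if uw: "(u, w) \<in> ?E" for u w
  proof (cases "u \<in> ?R")
    case True
    then have "(u \<in> M \<longleftrightarrow> w \<notin> M)" using M keep[OF True uw] by (auto simp: transversals_def)
    then show ?thesis using True sep[OF True uw] R by auto
  next
    case False
    then have u: "u \<in> ?S \<union> ?O" using edges_subset[OF cl uw] R by auto
    have "w \<notin> ?R" using sep[OF _ edges_sym[OF uw]] False by blast
    moreover have "w \<in> ?O" if "u \<in> ?S" 
      using that uw unfolding same_side_def other_side_def mem_Collect_eq by (metis even_Suc relpow_Suc_I)
    moreover have "w \<in> ?S" if "u \<in> ?O" 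
      using that uw unfolding same_side_def other_side_def mem_Collect_eq by (metis even_Suc relpow_Suc_I)
    ultimately show ?thesis using u dis False M by (auto simp: transversals_def)
  qed
  moreover have "M \<union> ?O \<subseteq> V" using M SV R by (auto simp: transversals_def)
  ultimately show "M \<union> ?O \<in> transversals V K" by (auto simp: transversals_def)
qed

definition balanced_mean :: "'a set \<Rightarrow> 'a set set \<Rightarrow> (('a set \<Rightarrow> real) \<Rightarrow> real) \<Rightarrow> bool" where
  "balanced_mean V K L \<longleftrightarrow> is_mean (transversals V K) L \<and> (\<forall>v\<in>V. L (mem_sign v) = 0)"

text \<open>A balanced mean of the minor becomes a mean over the transversals that avoid \<open>v\<close> and is still
  balanced off the component of \<open>v\<close>.\<close>

lemma lift_mean:
  assumes T: "tangled_covers V K" and v: "v \<in> V"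
    and L: "balanced_mean (off_component V K v) (side_minor V K v) L"
  shows "is_mean {M \<in> transversals V K. v \<notin> M} (\<lambda>g. L (\<lambda>M. g (M \<union> other_side K v)))"
    and "u \<in> off_component V K v \<Longrightarrow> L (\<lambda>M. mem_sign u (M \<union> other_side K v)) = 0"
proof -
  let ?R = "off_component V K v" and ?K = "side_minor V K v"
  have cl: "clean_covers V K" and ns: "no_small K" using T by (auto simp: tangled_covers_def)
  have finV: "finite V" by (rule clean_covers_finite[OF cl])
  have vO: "v \<notin> other_side K v" using sides_disjoint[OF cl ns, of v] side_member[of v K] by auto
  have RO: "u \<notin> other_side K v" if "u \<in> ?R" for u using that sides_component[of K v] by (auto simp: off_component_def)
  have vM: "v \<notin> M" if "M \<in> transversals ?R ?K" for M using that by (auto simp: transversals_def off_component_def)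
  show "is_mean {M \<in> transversals V K. v \<notin> M} (\<lambda>g. L (\<lambda>M. g (M \<union> other_side K v)))"
  proof (rule mean_map[of "transversals ?R ?K" L _ "\<lambda>M. M \<union> other_side K v"])
    show "is_mean (transversals ?R ?K) L" using L by (simp add: balanced_mean_def)
    show "finite (transversals ?R ?K)" by (rule finite_transversals) (simp add: off_component_def finV)
    show "finite {M \<in> transversals V K. v \<notin> M}" using finite_transversals[OF finV] by simp
    show "(\<lambda>M. M \<union> other_side K v) ` transversals ?R ?K \<subseteq> {M \<in> transversals V K. v \<notin> M}"
      using tangled_side_minor(2)[OF T v] vO vM by blast
  qed
  assume u: "u \<in> ?R"
  then have "(\<lambda>M. mem_sign u (M \<union> other_side K v)) = mem_sign u" using RO by (auto simp: mem_sign_def)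
  then show "L (\<lambda>M. mem_sign u (M \<union> other_side K v)) = 0" using L u by (simp add: balanced_mean_def)
qed

lemma off_component_neighbour: "(v, w) \<in> edges K \<Longrightarrow> off_component V K w = off_component V K v"
  using sides_component[of K v] sides_component[of K w] sides_neighbour[of v w K] by (auto simp: off_component_def)

text \<open>For an edge \<open>{v, w}\<close>, the transversals avoiding \<open>v\<close> are those containing \<open>w\<close>. On them the sign at \<open>v\<close> is -1, on
  those avoiding \<open>w\<close> it is 1. So the average of one mean of each kind is balanced on the component of \<open>v\<close> as well,
  and the two equations compute it on functions with the factor \<open>mem_sign v\<close>.\<close>

lemma mix_means:
  assumes T: "tangled_covers V K" and vw: "(v, w) \<in> edges K"
    and L: "is_mean {M \<in> transversals V K. v \<notin> M} L" "\<forall>u\<in>off_component V K v. L (mem_sign u) = 0"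
    and L': "is_mean {M \<in> transversals V K. w \<notin> M} L'" "\<forall>u\<in>off_component V K w. L' (mem_sign u) = 0"
  shows "balanced_mean V K (\<lambda>g. (L g + L' g) / 2)"
    and "L (\<lambda>M. mem_sign v M * g M) = - L g" and "L' (\<lambda>M. mem_sign v M * g M) = L' g"
proof -
  have fin: "finite (transversals V K)"
    using T clean_covers_finite finite_transversals by (auto simp: tangled_covers_def)
  show sv: "L (\<lambda>M. mem_sign v M * g M) = - L g" "L' (\<lambda>M. mem_sign v M * g M) = L' g" for g
  proof -
    have "L (\<lambda>M. mem_sign v M * g M) = L (\<lambda>M. (-1) * g M)"
      by (rule mean_cong[OF L(1)]) (auto simp: mem_sign_def)
    then show "L (\<lambda>M. mem_sign v M * g M) = - L g" using mean_scale[OF L(1), of "-1" g] by simp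
    show "L' (\<lambda>M. mem_sign v M * g M) = L' g"
      by (rule mean_cong[OF L'(1)]) (use vw in \<open>auto simp: mem_sign_def transversals_def\<close>)
  qed
  let ?A = "\<lambda>g. (L g + L' g) / 2"
  have mean: "is_mean (transversals V K) ?A" by (rule mean_mix[OF L(1) L'(1)]) (use fin in auto)
  have v0: "?A (mem_sign v) = 0"
  proof -
    have "L (mem_sign v) = - L (\<lambda>_. 1)" "L' (mem_sign v) = L' (\<lambda>_. 1)" using sv[of "\<lambda>_. 1"] by simp_all
    moreover have "L (\<lambda>_. 1) = 1" "L' (\<lambda>_. 1) = 1" using mean_const[OF L(1)] mean_const[OF L'(1)] by auto
    ultimately show ?thesis by simp
  qed
  have "?A (mem_sign u) = 0" if u: "u \<in> V" for u
  proof (cases "u \<in> off_component V K v")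
    case True
    then show ?thesis using L(2) L'(2) off_component_neighbour[OF vw] by simp
  next
    case False
    then obtain n where "(v, u) \<in> edges K ^^ n" using u by (auto simp: off_component_def rtrancl_power)
    then have "?A (mem_sign u) = ?A (\<lambda>M. (-1) ^ n * mem_sign v M)"
      by (intro mean_cong[OF mean] mem_sign_walk)
    also have "\<dots> = (-1) ^ n * ?A (mem_sign v)" by (rule mean_scale[OF mean])
    finally show ?thesis using v0 by simp
  qed
  then show "balanced_mean V K ?A" using mean by (simp add: balanced_mean_def)
qed

text \<open>Doubling the weights of such a mean gives a fractional packing of value two. The
  induction removes one component at a time.\<close>

lemma balanced_mean_exists: "tangled_covers V K \<Longrightarrow> \<exists>L. balanced_mean V K L"
proof (induction "card V" arbitrary: V K rule: less_induct)
  case less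
  note T = less.prems
  have finV: "finite V" using T clean_covers_finite by (auto simp: tangled_covers_def)
  show ?case
  proof (cases "V = {}")
    case True
    have "transversals V K = {{}}"
      using True T edges_subset[of V K] by (auto simp: transversals_def tangled_covers_def no_small_def)
    then have "is_mean (transversals V K) (\<lambda>g. g {})"
      unfolding is_mean_def by (intro exI[of _ "\<lambda>_. 1"]) simp
    then have "balanced_mean V K (\<lambda>g. g {})" using True by (simp add: balanced_mean_def)
    then show ?thesis by blast
  next
    case False
    then obtain v where "v \<in> V" by blast
    then obtain w where v: "v \<in> V" "(v, w) \<in> edges K" and w: "w \<in> V" using tangled_neighbour[OF T] by metis
    have "\<exists>L. is_mean {M \<in> transversals V K. x \<notin> M} L \<and> (\<forall>u\<in>off_component V K x. L (mem_sign u) = 0)" if x: "x \<in> V" for x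
    proof -
      have "off_component V K x \<subset> V" using x by (auto simp: off_component_def)
      then have "card (off_component V K x) < card V" by (rule psubset_card_mono[OF finV])
      then have "\<exists>L. balanced_mean (off_component V K x) (side_minor V K x) L"
        by (rule less.hyps[OF _ tangled_side_minor(1)[OF T x]])
      then obtain L where L: "balanced_mean (off_component V K x) (side_minor V K x) L" by (elim exE)
      show ?thesis
        by (rule exI[of _ "\<lambda>g. L (\<lambda>M. g (M \<union> other_side K x))"], intro conjI ballI)
          (rule lift_mean(1)[OF T x L], rule lift_mean(2)[OF T x L])
    qed
    from this[OF v(1)] this[OF w] obtain L L' where
      "is_mean {M \<in> transversals V K. v \<notin> M} L" "\<forall>u\<in>off_component V K v. L (mem_sign u) = 0"
      "is_mean {M \<in> transversals V K. w \<notin> M} L'" "\<forall>u\<in>off_component V K w. L' (mem_sign u) = 0"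
      by (elim exE conjE)
    then have "balanced_mean V K (\<lambda>g. (L g + L' g) / 2)"
      by (intro mix_means(1)[OF T v(2), of L L']) simp_all
    then show ?thesis by (rule exI[where P = "balanced_mean V K"])
  qed
qed

lemma conditional_mean_exists:
  assumes T: "tangled_covers V K" and v: "v \<in> V"
  shows "\<exists>L. is_mean {M \<in> transversals V K. v \<notin> M} L \<and> (\<forall>u\<in>off_component V K v. L (mem_sign u) = 0)"
proof -
  obtain L where L: "balanced_mean (off_component V K v) (side_minor V K v) L"
    using balanced_mean_exists[OF tangled_side_minor(1)[OF T v]] by (elim exE)
  show ?thesis
    by (rule exI[of _ "\<lambda>g. L (\<lambda>M. g (M \<union> other_side K v))"], intro conjI ballI)
      (rule lift_mean(1)[OF T v L], rule lift_mean(2)[OF T v L])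
qed

text \<open>Both halves of the mixture at \<open>i\<close> are balanced at \<open>j\<close>.\<close>

lemma pair_mean:
  assumes T: "tangled_covers V K" and ij: "i \<in> V" "j \<in> off_component V K i"
  shows "\<exists>L. balanced_mean V K L \<and> L (\<lambda>M. mem_sign i M * mem_sign j M) = 0"
proof -
  obtain w where w: "(i, w) \<in> edges K" and wV: "w \<in> V" by (rule tangled_neighbour[OF T ij(1)])
  obtain L where L: "is_mean {M \<in> transversals V K. i \<notin> M} L" "\<forall>u\<in>off_component V K i. L (mem_sign u) = 0"
    using conditional_mean_exists[OF T ij(1)] by (elim exE conjE)
  obtain L' where L': "is_mean {M \<in> transversals V K. w \<notin> M} L'" "\<forall>u\<in>off_component V K w. L' (mem_sign u) = 0"
    using conditional_mean_exists[OF T wV] by (elim exE conjE)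
  note m = mix_means[OF T w L L']
  have "L (mem_sign j) = 0" "L' (mem_sign j) = 0" using L(2) L'(2) ij(2) off_component_neighbour[OF w] by simp_all
  then have "(L (\<lambda>M. mem_sign i M * mem_sign j M) + L' (\<lambda>M. mem_sign i M * mem_sign j M)) / 2 = 0"
    using m(2,3)[of "mem_sign j"] by simp
  then show ?thesis by (intro exI[of _ "\<lambda>g. (L g + L' g) / 2"] conjI m(1))
qed

text \<open>Once the sign at \<open>i\<close> is fixed, the components of \<open>j\<close> and \<open>k\<close> either have merged in the minor, where the product of
  their signs is constant, or they are still apart and \<open>pair_mean\<close> makes the mean of the product 0. If
  the mean \<open>(a + b) / 2\<close> of the product over both halves is 0, then multiplying by the sign at \<open>i\<close> gives
  \<open>(b - a) / 2 = - a\<close>.\<close>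

lemma triple_mean:
  assumes T: "tangled_covers V K" and ijk: "i \<in> V" "j \<in> off_component V K i" "k \<in> off_component V K i"
  shows "\<exists>L. balanced_mean V K L \<and> (L (\<lambda>M. mem_sign j M * mem_sign k M) = 0 \<longrightarrow>
     L (\<lambda>M. mem_sign i M * (mem_sign j M * mem_sign k M)) \<in> {-1, 0, 1})"
proof -
  let ?R = "off_component V K i" and ?K = "side_minor V K i" and ?g = "\<lambda>M. mem_sign j M * mem_sign k M"
  obtain w where w: "(i, w) \<in> edges K" and wV: "w \<in> V" by (rule tangled_neighbour[OF T ijk(1)])
  have T': "tangled_covers ?R ?K" by (rule tangled_side_minor(1)[OF T ijk(1)])
  obtain L1 where L1: "balanced_mean ?R ?K L1" "L1 ?g \<in> {-1, 0, 1}"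
  proof (cases "k \<in> off_component ?R ?K j")
    case True
    obtain L1 where "balanced_mean ?R ?K L1" "L1 ?g = 0"
      using pair_mean[OF T' ijk(2) True] by (elim exE conjE)
    then show thesis using that by simp
  next
    case False
    then obtain n where n: "(j, k) \<in> edges ?K ^^ n" using ijk by (auto simp: off_component_def rtrancl_power)
    obtain L1 where L1: "balanced_mean ?R ?K L1" using balanced_mean_exists[OF T'] by (elim exE)
    have "L1 ?g = (-1) ^ n"
    proof (rule mean_const[of "transversals ?R ?K" L1 ?g])
      show "is_mean (transversals ?R ?K) L1" using L1 by (simp add: balanced_mean_def)
      fix M assume "M \<in> transversals ?R ?K"
      then have "mem_sign k M = (-1) ^ n * mem_sign j M" using n by (rule mem_sign_walk)
      then show "?g M = (-1) ^ n" by (auto simp: mem_sign_def)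
    qed
    then show thesis using that[OF L1] by (cases "even n") auto
  qed
  define L where "L = (\<lambda>g. L1 (\<lambda>M. g (M \<union> other_side K i)))"
  have L: "is_mean {M \<in> transversals V K. i \<notin> M} L" "\<forall>u\<in>off_component V K i. L (mem_sign u) = 0"
    unfolding L_def using lift_mean[OF T ijk(1) L1(1)] by auto
  obtain L' where L': "is_mean {M \<in> transversals V K. w \<notin> M} L'" "\<forall>u\<in>off_component V K w. L' (mem_sign u) = 0"
    using conditional_mean_exists[OF T wV] by (elim exE conjE)
  note m = mix_means[OF T w L L']
  have "(\<lambda>M. ?g (M \<union> other_side K i)) = ?g"
    using ijk(2,3) sides_component[of K i] by (auto simp: mem_sign_def off_component_def fun_eq_iff)
  then have "L ?g = L1 ?g" by (simp add: L_def)
  show ?thesis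
  proof (intro exI[of _ "\<lambda>g. (L g + L' g) / 2"] conjI impI m(1))
    assume "(L ?g + L' ?g) / 2 = 0"
    then have "L' ?g = - L ?g" by simp
    then have "(L (\<lambda>M. mem_sign i M * ?g M) + L' (\<lambda>M. mem_sign i M * ?g M)) / 2 = - L ?g"
      unfolding m(2,3) by simp
    then show "(L (\<lambda>M. mem_sign i M * ?g M) + L' (\<lambda>M. mem_sign i M * ?g M)) / 2 \<in> {-1, 0, 1}"
      using L1(2) \<open>L ?g = L1 ?g\<close> by auto
  qed
qed

section \<open>From clutters to families of covers\<close>

lemma minimal_sets_below:
  assumes "finite X" "X \<in> F"
  obtains Y where "Y \<in> minimal_sets F" "Y \<subseteq> X"
proof -
  have "\<exists>Y\<in>minimal_sets F. Y \<subseteq> X"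
    using assms
  proof (induction X rule: finite_psubset_induct)
    case (psubset X)
    show ?case
    proof (cases "X \<in> minimal_sets F")
      case False
      then obtain Y where Y: "Y \<in> F" "Y \<subset> X" using psubset.prems unfolding minimal_sets_def by blast
      then obtain Z where "Z \<in> minimal_sets F" "Z \<subseteq> Y" using psubset.IH[OF Y(2,1)] by blast
      then show ?thesis using Y(2) by blast
    qed blast
  qed
  then show thesis using that by blast
qed

lemma clutter_finite: "clutter V C \<Longrightarrow> finite V"
  and clutter_subset: "clutter V C \<Longrightarrow> M \<in> C \<Longrightarrow> M \<subseteq> V"
  and clutter_antichain: "clutter V C \<Longrightarrow> M \<in> C \<Longrightarrow> N \<in> C \<Longrightarrow> M \<subseteq> N \<Longrightarrow> M = N"
  by (simp_all add: clutter_def)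

lemma clutter_finite_members: "clutter V C \<Longrightarrow> finite C"
  by (rule finite_subset[of C "Pow V"]) (use clutter_subset clutter_finite in blast)+

lemma clutter_minimal_sets: "finite R \<Longrightarrow> F \<subseteq> Pow R \<Longrightarrow> clutter R (minimal_sets F)"
  by (auto simp: clutter_def minimal_sets_def)

lemma covers_minimal_sets:
  assumes "finite R" "F \<subseteq> Pow R"
  shows "covers R (minimal_sets F) = covers R F"
proof -
  have "B \<inter> M \<noteq> {}" if B: "\<forall>M\<in>minimal_sets F. B \<inter> M \<noteq> {}" and M: "M \<in> F" for B M
  proof -
    have "finite M" using assms M finite_subset by blast
    then obtain Y where "Y \<in> minimal_sets F" "Y \<subseteq> M" using minimal_sets_below[OF _ M] by blast
    then show ?thesis using B by blast
  qed
  moreover have "minimal_sets F \<subseteq> F" by (auto simp: minimal_sets_def)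
  ultimately show ?thesis unfolding covers_def by blast
qed

text \<open>A clutter is determined by its covers: the complement of a member is not a cover, so every
  member of one clutter contains a member of the other.\<close>

lemma clutter_eqI:
  assumes "clutter R A" "clutter R B" "covers R A = covers R B"
  shows "A = B"
proof -
  have below: "\<exists>M'\<in>B. M' \<subseteq> M" if "M \<in> A" "clutter R A" "clutter R B" "covers R A = covers R B" for A B M
  proof -
    have "R - M \<notin> covers R A" using that(1) unfolding covers_def by blast
    then have "R - M \<notin> covers R B" using that(4) by simp
    then obtain M' where "M' \<in> B" "(R - M) \<inter> M' = {}" unfolding covers_def by blast
    then have "M' \<subseteq> M" using clutter_subset[OF that(3)] by blast
    then show ?thesis using \<open>M' \<in> B\<close> by blast
  qed
  have sub: "A \<subseteq> B" if AB: "clutter R A" "clutter R B" "covers R A = covers R B" for A B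
  proof
    fix M assume "M \<in> A"
    then obtain M' where M': "M' \<in> B" "M' \<subseteq> M" using below[OF _ AB] by blast
    then obtain M'' where "M'' \<in> A" "M'' \<subseteq> M'" using below[OF M'(1) AB(2,1) AB(3)[symmetric]] by blast
    moreover from this have "M'' = M" using clutter_antichain[OF AB(1) _ \<open>M \<in> A\<close>, of M''] M'(2) by blast
    ultimately have "M' = M" using M' by blast
    then show "M \<in> B" using M'(1) by simp
  qed
  show ?thesis using sub[OF assms] sub[OF assms(2,1) assms(3)[symmetric]] by blast
qed

text \<open>Contracted elements belong to no \<open>B \<subseteq> R\<close>, so removing them from a member does not change
  whether \<open>B\<close> intersects it; members meeting \<open>I\<close> are covered by \<open>I\<close> itself.\<close>

lemma minor_covers:
  assumes C: "clutter V C" and I: "I \<subseteq> V" "R \<subseteq> V" "I \<inter> R = {}"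
  shows "clutter R (minor C I (V - (I \<union> R)))"
    and "covers R (minor C I (V - (I \<union> R))) = cover_minor (covers V C) I R"
proof -
  let ?F = "{M - (V - (I \<union> R)) | M. M \<in> C \<and> M \<inter> I = {}}"
  have CV: "M \<subseteq> V" if "M \<in> C" for M by (rule clutter_subset[OF C that])
  have fin: "finite R" by (rule finite_subset[OF I(2) clutter_finite[OF C]])
  have F: "?F \<subseteq> Pow R" using CV by blast
  show "clutter R (minor C I (V - (I \<union> R)))"
    unfolding minor_def by (rule clutter_minimal_sets[OF fin F])
  have "B \<inter> (M - (V - (I \<union> R))) = B \<inter> M" if "B \<subseteq> R" for B M using that by blast
  moreover have "B \<in> covers R ?F \<longleftrightarrow> B \<subseteq> R \<and> (\<forall>M\<in>C. M \<inter> I = {} \<longrightarrow> B \<inter> (M - (V - (I \<union> R))) \<noteq> {})" for B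
    unfolding covers_def by blast
  ultimately have "B \<in> covers R ?F \<longleftrightarrow> B \<subseteq> R \<and> (\<forall>M\<in>C. M \<inter> I = {} \<longrightarrow> B \<inter> M \<noteq> {})" for B
    by (cases "B \<subseteq> R") simp_all
  moreover have "B \<in> cover_minor (covers V C) I R \<longleftrightarrow> B \<subseteq> R \<and> (\<forall>M\<in>C. (B \<union> I) \<inter> M \<noteq> {})" for B
    using I unfolding cover_minor_def covers_def by blast
  moreover have "(\<forall>M\<in>C. (B \<union> I) \<inter> M \<noteq> {}) \<longleftrightarrow> (\<forall>M\<in>C. M \<inter> I = {} \<longrightarrow> B \<inter> M \<noteq> {})" for B
    by blast
  ultimately have "covers R ?F = cover_minor (covers V C) I R" by (simp add: set_eq_iff)
  then show "covers R (minor C I (V - (I \<union> R))) = cover_minor (covers V C) I R"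
    unfolding minor_def covers_minimal_sets[OF fin F] .
qed

text \<open>If \<open>B\<close> contains no member of \<open>E\<close>, then \<open>R - B\<close> is a cover of \<open>E\<close> disjoint from \<open>B\<close>.\<close>

lemma covers_blocker:
  assumes "finite R" "E \<subseteq> Pow R"
  shows "covers R (blocker R E) = {B. B \<subseteq> R \<and> (\<exists>M\<in>E. M \<subseteq> B)}"
proof -
  have "\<exists>M\<in>E. M \<subseteq> B" if B: "B \<in> covers R (covers R E)" for B
  proof (rule ccontr)
    assume "\<not> ?thesis"
    then have "R - B \<in> covers R E" using assms(2) unfolding covers_def by blast
    then show False using B unfolding covers_def by blast
  qed
  moreover have "B \<in> covers R (covers R E)" if "B \<subseteq> R" "M \<in> E" "M \<subseteq> B" for B M
    using that unfolding covers_def by blast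
  moreover have "B \<subseteq> R" if "B \<in> covers R (covers R E)" for B
    using that unfolding covers_def by blast
  ultimately have "covers R (covers R E) = {B. B \<subseteq> R \<and> (\<exists>M\<in>E. M \<subseteq> B)}" by blast
  moreover have "covers R E \<subseteq> Pow R" by (auto simp: covers_def)
  ultimately show ?thesis
    unfolding blocker_def using covers_minimal_sets[OF assms(1)] by metis
qed

lemma delta_covers_minor:
  assumes R: "finite R" and K: "K \<subseteq> Pow R" "no_small K" "\<And>A B. A \<in> K \<Longrightarrow> A \<subseteq> B \<Longrightarrow> B \<subseteq> R \<Longrightarrow> B \<in> K"
    and D: "delta_covers R K" and F: "clutter R F" "covers R F = K"
  shows "is_delta R F"
proof -
  obtain t X where tX: "R = insert t X" "t \<notin> X" "X \<in> K" and Xmin: "\<And>Y. Y \<in> K \<Longrightarrow> Y \<subseteq> X \<Longrightarrow> Y = X"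
    and edge: "\<And>x. x \<in> X \<Longrightarrow> {t, x} \<in> K"
    using D by (auto simp: delta_covers_def)
  have finX: "finite X" using R tX by simp
  have Xns: "X \<noteq> {}" "\<And>x. X \<noteq> {x}" using tX(3) K(2) unfolding no_small_def by metis+
  then have "card X \<noteq> 0" "card X \<noteq> 1" using finX by (auto simp: card_1_singleton_iff)
  then have c2: "card X \<ge> 2" by linarith
  let ?n = "card X + 1"
  have "card {2..?n} = card X" by simp
  then obtain e where e: "bij_betw e {2..?n} X"
    using finX finite_same_card_bij[of "{2..?n}" X] by auto
  define a where "a = e(1 := t)"
  have aX: "a ` {2..?n} = X" using e by (auto simp: a_def bij_betw_def)
  have "{1..?n} = insert 1 {2..?n}" by auto
  moreover have "bij_betw a {2..?n} X" using e by (rule bij_betw_cong[THEN iffD1, rotated]) (auto simp: a_def)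
  ultimately have bij: "bij_betw a {1..?n} R"
    unfolding tX(1) using tX(2) bij_betw_combine[of a "{1}" "{t}" "{2..?n}" X] by (auto simp: a_def)
  let ?E = "insert X {{t, x} | x. x \<in> X}"
  have E: "insert (a ` {2..?n}) {{a 1, a i} | i. i \<in> {2..?n}} = ?E"
  proof -
    have "{{a 1, a i} | i. i \<in> {2..?n}} = (\<lambda>x. {t, x}) ` (a ` {2..?n})"
      unfolding Setcompr_eq_image image_image by (simp add: a_def)
    then show ?thesis unfolding aX by (simp add: Setcompr_eq_image)
  qed
  have "clutter R ?E"
    unfolding clutter_def using R tX(1,2) Xns
    by (auto simp: doubleton_eq_iff subset_insert_iff split: if_splits)
  moreover have "covers R ?E = K"
  proof (rule set_eqI)
    fix B
    have cov: "B \<in> covers R ?E \<longleftrightarrow> B \<subseteq> R \<and> B \<inter> X \<noteq> {} \<and> (t \<in> B \<or> X \<subseteq> B)"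
      by (auto simp: covers_def)
    show "B \<in> covers R ?E \<longleftrightarrow> B \<in> K"
    proof
      assume "B \<in> covers R ?E"
      then obtain x where x: "B \<subseteq> R" "x \<in> B" "x \<in> X" "t \<in> B \<or> X \<subseteq> B" using cov by blast
      then show "B \<in> K" using K(3)[OF edge[OF x(3)], of B] K(3)[OF tX(3), of B] by blast
    next
      assume B: "B \<in> K"
      then have BR: "B \<subseteq> R" using K(1) by blast
      have "B \<noteq> {}" "B \<noteq> {t}" using B K(2) unfolding no_small_def by metis+
      then have "B \<inter> X \<noteq> {}" using BR tX(1) by blast
      moreover have "t \<in> B \<or> X \<subseteq> B" using Xmin[OF B] BR tX(1) by blast
      ultimately show "B \<in> covers R ?E" using cov BR by blast
    qed
  qed
  ultimately have "F = ?E" using clutter_eqI[OF F(1)] F(2) by simp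
  then have "F = insert (a ` {2..?n}) {{a 1, a i} | i. i \<in> {2..?n}}" using E by simp
  moreover have "?n \<ge> 3" using c2 by simp
  ultimately show ?thesis unfolding is_delta_def using bij by blast
qed

lemma odd_hole_covers_minor:
  assumes R: "finite R" and K: "K \<subseteq> Pow R" "no_small K" "\<And>A B. A \<in> K \<Longrightarrow> A \<subseteq> B \<Longrightarrow> B \<subseteq> R \<Longrightarrow> B \<in> K"
    and D: "odd_hole_covers R K" and F: "clutter R F" "covers R F = K"
  shows "\<exists>E. is_extended_odd_hole R E \<and> F = blocker R E"
proof -
  obtain n a where n: "n \<ge> (5::nat)" "odd n" and bij: "bij_betw a {..<n} R"
    and adj: "\<And>i j. i < j \<Longrightarrow> j < n \<Longrightarrow> {a i, a j} \<in> K \<longleftrightarrow> j = Suc i \<or> (i = 0 \<and> j = n - 1)"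
    using D unfolding odd_hole_covers_def by blast
  let ?E = "minimal_sets K"
  have clE: "clutter R ?E" by (rule clutter_minimal_sets[OF R K(1)])
  have EK: "?E \<subseteq> K" by (auto simp: minimal_sets_def)
  have ER: "?E \<subseteq> Pow R" using EK K(1) by blast
  have fin: "finite M" if "M \<in> K" for M using that K(1) R finite_subset by blast
  have card2: "card M \<ge> 2" if "M \<in> K" for M
  proof -
    have "M \<noteq> {}" "\<And>x. M \<noteq> {x}" using that K(2) unfolding no_small_def by metis+
    then have "card M \<noteq> 0" "card M \<noteq> 1" using fin[OF that] by (auto simp: card_1_singleton_iff)
    then show ?thesis by linarith
  qed
  have pairE: "M \<in> ?E" if "M \<in> K" "card M = 2" for M
  proof -
    have "Y = M" if "Y \<in> K" "Y \<subseteq> M" for Y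
      using card_seteq[OF fin[OF \<open>M \<in> K\<close>] that(2)] card2[OF that(1)] \<open>card M = 2\<close> by simp
    then show ?thesis using that(1) by (simp add: minimal_sets_def)
  qed
  have neq: "a i \<noteq> a j" if "i < j" "j < n" for i j
    using that bij by (auto simp: bij_betw_def inj_on_def)
  have short: "{M \<in> ?E. \<forall>N\<in>?E. card M \<le> card N} = {M \<in> K. card M = 2}"
  proof -
    have "{a 0, a 1} \<in> K" using adj[of 0 1] n by simp
    moreover have "card {a 0, a 1} = 2" using neq[of 0 1] n by simp
    ultimately have ex: "{a 0, a 1} \<in> ?E" "card {a 0, a 1} = 2" using pairE by auto
    show ?thesis
    proof (intro set_eqI iffI)
      fix M assume M: "M \<in> {M \<in> ?E. \<forall>N\<in>?E. card M \<le> card N}"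
      then have "card M \<le> 2" using ex by force
      moreover have "M \<in> K" using M EK by blast
      ultimately show "M \<in> {M \<in> K. card M = 2}" using card2[of M] by simp
    next
      fix M assume "M \<in> {M \<in> K. card M = 2}"
      then show "M \<in> {M \<in> ?E. \<forall>N\<in>?E. card M \<le> card N}" using pairE card2 EK by auto
    qed
  qed
  define b where "b = (\<lambda>i. a (i - 1))"
  have "bij_betw (\<lambda>i. i - 1) {1..n} {..<n}"
    by (rule bij_betw_byWitness[of _ Suc]) auto
  then have bijb: "bij_betw b {1..n} R"
    using bij_betw_trans[OF _ bij] unfolding b_def comp_def by blast
  have "{M \<in> K. card M = 2} = insert {b n, b 1} {{b i, b (i + 1)} | i. i \<in> {1..<n}}"
  proof (intro set_eqI iffI)
    fix M assume M: "M \<in> {M \<in> K. card M = 2}"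
    then obtain x y where xy: "M = {x, y}" "x \<noteq> y" by (auto simp: card_2_iff)
    have "M \<subseteq> R" using M K(1) by auto
    then obtain i j where "x = a i" "y = a j" "i < n" "j < n" using xy bij by (auto simp: bij_betw_def)
    then obtain i j where ij: "M = {a i, a j}" "i < j" "j < n"
      using xy by (metis insert_commute linorder_neqE_nat)
    then consider "j = Suc i" | "i = 0" "j = n - 1" using adj[OF ij(2,3)] M by auto
    then show "M \<in> insert {b n, b 1} {{b i, b (i + 1)} | i. i \<in> {1..<n}}"
    proof cases
      case 1
      then have "M = {b (i + 1), b (i + 1 + 1)}" "i + 1 \<in> {1..<n}" using ij by (auto simp: b_def)
      then show ?thesis by blast
    next
      case 2
      then show ?thesis using ij by (auto simp: b_def insert_commute)
    qed
  next
    fix M assume "M \<in> insert {b n, b 1} {{b i, b (i + 1)} | i. i \<in> {1..<n}}"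
    then consider "M = {a 0, a (n - 1)}" | i where "M = {a (i - 1), a i}" "i \<in> {1..<n}"
      by (auto simp: b_def insert_commute)
    then obtain i j where ij: "M = {a i, a j}" "i < j" "j < n" "j = Suc i \<or> (i = 0 \<and> j = n - 1)"
    proof cases
      case 1
      then show thesis using that[of 0 "n - 1"] n by auto
    next
      case (2 i)
      then show thesis using that[of "i - 1" i] by auto
    qed
    then show "M \<in> {M \<in> K. card M = 2}" using adj[OF ij(2,3)] neq[OF ij(2,3)] by simp
  qed
  then have "is_extended_odd_hole R ?E"
    unfolding is_extended_odd_hole_def using clE short n bijb by auto
  moreover have "F = blocker R ?E"
  proof (rule clutter_eqI[OF F(1)])
    show "clutter R (blocker R ?E)"
      unfolding blocker_def by (rule clutter_minimal_sets[OF R]) (auto simp: covers_def)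
    have "{B. B \<subseteq> R \<and> (\<exists>M\<in>?E. M \<subseteq> B)} = K"
    proof (intro set_eqI iffI)
      fix B assume B: "B \<in> K"
      obtain Y where "Y \<in> ?E" "Y \<subseteq> B" by (rule minimal_sets_below[OF fin[OF B] B])
      then show "B \<in> {B. B \<subseteq> R \<and> (\<exists>M\<in>?E. M \<subseteq> B)}"
        using K(1) B by blast
    next
      fix B assume "B \<in> {B. B \<subseteq> R \<and> (\<exists>M\<in>?E. M \<subseteq> B)}"
      then show "B \<in> K" using K(3) EK by blast
    qed
    then show "covers R F = covers R (blocker R ?E)" using F(2) covers_blocker[OF R ER] by simp
  qed
  ultimately show ?thesis by blast
qed

lemma clean_covers_covers:
  assumes C: "clutter V C" and cl: "clean V C"
  shows "clean_covers V (covers V C)"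
proof -
  let ?K = "covers V C"
  have up: "B \<in> ?K" if "A \<in> ?K" "A \<subseteq> B" "B \<subseteq> V" for A B
    using that unfolding covers_def by blast
  have "\<not> delta_covers R (cover_minor ?K I R) \<and> \<not> odd_hole_covers R (cover_minor ?K I R)"
    if I: "I \<subseteq> V" "R \<subseteq> V" "I \<inter> R = {}" and ns: "no_small (cover_minor ?K I R)" for I R
  proof -
    let ?M = "minor C I (V - (I \<union> R))"
    have R: "V - (I \<union> (V - (I \<union> R))) = R" using I by blast
    have "finite R" by (rule finite_subset[OF I(2) clutter_finite[OF C]])
    moreover have "cover_minor ?K I R \<subseteq> Pow R" by (auto simp: cover_minor_def)
    moreover have "B \<in> cover_minor ?K I R" if "A \<in> cover_minor ?K I R" "A \<subseteq> B" "B \<subseteq> R" for A B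
      using that up[of "A \<union> I" "B \<union> I"] I by (auto simp: cover_minor_def)
    ultimately have "delta_covers R (cover_minor ?K I R) \<Longrightarrow> is_delta R ?M"
      "odd_hole_covers R (cover_minor ?K I R) \<Longrightarrow> \<exists>E. is_extended_odd_hole R E \<and> ?M = blocker R E"
      using delta_covers_minor[of R "cover_minor ?K I R" ?M] odd_hole_covers_minor[of R "cover_minor ?K I R" ?M]
        ns minor_covers[OF C I] by blast+
    moreover have "\<not> is_delta R ?M \<and> \<not> (\<exists>E. is_extended_odd_hole R E \<and> ?M = blocker R E)"
      using cl[unfolded clean_def, rule_format, of I "V - (I \<union> R)"] I(1) unfolding R by blast
    ultimately show ?thesis by blast
  qed
  then show ?thesis
    unfolding clean_covers_def using clutter_finite[OF C] up by (auto simp: covers_def)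
qed

lemma tangled_minimum_covers:
  assumes "tangled V C"
  shows "B \<in> covers V C \<Longrightarrow> card B \<ge> 2" and "minimum_covers V C = {B \<in> covers V C. card B = 2}"
proof -
  have 2: "covering_number V C = 2" using assms by (simp add: tangled_def)
  have two: "enat n = 2 \<longleftrightarrow> n = 2" "(2::enat) \<le> enat n \<longleftrightarrow> 2 \<le> n" for n
    by (metis enat.inject numeral_eq_enat) (metis enat_ord_simps(1) numeral_eq_enat)
  show "minimum_covers V C = {B \<in> covers V C. card B = 2}"
    unfolding minimum_covers_def 2 two ..
  assume "B \<in> covers V C"
  then have "covering_number V C \<le> enat (card B)" unfolding covering_number_def by (rule INF_lower)
  then show "card B \<ge> 2" unfolding 2 two .
qed

lemma tangled_covers_covers:
  assumes C: "clutter V C" and cl: "clean V C" and T: "tangled V C"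
  shows "tangled_covers V (covers V C)" and "{(s, t). {s, t} \<in> minimum_covers V C} = edges (covers V C)"
proof -
  note mc = tangled_minimum_covers[OF T]
  have ns: "no_small (covers V C)" unfolding no_small_def using mc(1) by fastforce
  have eq: "{s, t} \<in> minimum_covers V C \<longleftrightarrow> {s, t} \<in> covers V C" for s t
  proof
    assume st: "{s, t} \<in> covers V C"
    then have "s \<noteq> t" using ns by (auto simp: no_small_def)
    then show "{s, t} \<in> minimum_covers V C" using st mc(2) by simp
  qed (simp add: mc(2))
  then show "{(s, t). {s, t} \<in> minimum_covers V C} = edges (covers V C)" by (simp add: edges_def)
  have "\<exists>u. (v, u) \<in> edges (covers V C)" if "v \<in> V" for v
  proof -
    have "\<exists>B\<in>minimum_covers V C. v \<in> B" using T that by (simp add: tangled_def)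
    then obtain B where B: "B \<in> minimum_covers V C" "v \<in> B" by blast
    then have "card B = 2" using mc(2) by simp
    then obtain u where "B = {v, u}" using B(2) by (auto simp: card_2_iff)
    then show ?thesis using B eq by (auto simp: edges_def)
  qed
  then show "tangled_covers V (covers V C)"
    unfolding tangled_covers_def using clean_covers_covers[OF C cl] ns by blast
qed

text \<open>A transversal \<open>M\<close> contains some member \<open>N\<close> of the clutter. As \<open>M\<close> has only one end of each
  edge and \<open>N\<close> intersects each edge, \<open>N\<close> contains every element of \<open>M\<close> that has a neighbour.\<close>

lemma transversals_subset_clutter:
  assumes "clutter V C" "tangled_covers V (covers V C)"
  shows "transversals V (covers V C) \<subseteq> C"
proof
  fix M assume M: "M \<in> transversals V (covers V C)"
  then obtain N where N: "N \<in> C" "(V - M) \<inter> N = {}"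
    by (auto simp: transversals_def covers_def)
  then have NM: "N \<subseteq> M" using clutter_subset[OF assms(1)] by blast
  have "v \<in> N" if v: "v \<in> M" for v
  proof -
    have "v \<in> V" using M v by (auto simp: transversals_def)
    then obtain u where u: "(v, u) \<in> edges (covers V C)" using tangled_neighbour[OF assms(2)] by metis
    then have "u \<notin> M" using M v by (auto simp: transversals_def)
    moreover have "{v, u} \<inter> N \<noteq> {}" using u N(1) by (auto simp: edges_def covers_def)
    ultimately show ?thesis using NM by blast
  qed
  then show "M \<in> C" using N(1) NM by (metis subsetI subset_antisym)
qed

text \<open>Both ends of an edge together carry load at most two, the value of the packing, while every
  member contains at least one end. So a member of positive weight contains exactly one.\<close>

lemma core_subset_transversals:
  assumes C: "clutter V C"
  shows "core V C \<subseteq> transversals V (covers V C)"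
proof
  fix M assume "M \<in> core V C"
  then obtain y where M: "M \<in> C" "y M > 0" and pack: "fractional_packing V C y" and y2: "(\<Sum>N\<in>C. y N) = 2"
    unfolding core_def by blast
  have y: "\<And>N. N \<in> C \<Longrightarrow> 0 \<le> y N" "(\<Sum>N\<in>C. y N) = 2"
    and load: "\<And>v. v \<in> V \<Longrightarrow> (\<Sum>N | N \<in> C \<and> v \<in> N. y N) \<le> 1"
    using pack y2 by (simp_all add: fractional_packing_def)
  have MV: "M \<subseteq> V" by (rule clutter_subset[OF C M(1)])
  have finC: "finite C" by (rule clutter_finite_members[OF C])
  have "u \<in> M \<longleftrightarrow> v \<notin> M" if uv: "(u, v) \<in> edges (covers V C)" for u v
  proof -
    have uvV: "u \<in> V" "v \<in> V" and hit: "\<And>N. N \<in> C \<Longrightarrow> u \<in> N \<or> v \<in> N"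
      using uv by (auto simp: edges_def covers_def)
    \<comment> \<open>The excess of the number of ends of the edge in \<open>N\<close> over one, weighted by \<open>y N\<close>.\<close>
    let ?h = "\<lambda>N. (if u \<in> N then y N else 0) + (if v \<in> N then y N else 0) - y N"
    have nonneg: "\<forall>N\<in>C. 0 \<le> ?h N" using hit y(1) by auto
    have "(\<Sum>N\<in>C. ?h N) \<le> 0"
      using load[OF uvV(1)] load[OF uvV(2)] y(2) finC
      by (simp add: sum.distrib sum_subtractf sum.inter_filter)
    then have "?h M = 0"
      using sum_nonneg_eq_0_iff[OF finC, of ?h] nonneg sum_nonneg[of C ?h] M(1) by fastforce
    then show ?thesis using M(2) by (auto split: if_splits)
  qed
  moreover have "V - M \<notin> covers V C" using M(1) by (auto simp: covers_def)
  ultimately show "M \<in> transversals V (covers V C)" using MV by (auto simp: transversals_def)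
qed

text \<open>Twice the weights of a balanced mean form a fractional packing: the load of \<open>v\<close> is
  \<open>L (mem_sign v) + 1 = 1\<close>.\<close>

lemma balanced_mean_core:
  assumes C: "clutter V C" and T: "tangled_covers V (covers V C)" and L: "balanced_mean V (covers V C) L"
  shows "is_mean (core V C) L"
proof -
  let ?T = "transversals V (covers V C)"
  have finC: "finite C" by (rule clutter_finite_members[OF C])
  have TC: "?T \<subseteq> C" by (rule transversals_subset_clutter[OF C T])
  then have finT: "finite ?T" using finC finite_subset by blast
  obtain y where y: "\<forall>M\<in>?T. 0 \<le> y M" "sum y ?T = 1" "\<And>g. L g = (\<Sum>M\<in>?T. y M * g M)"
    using L by (auto simp: balanced_mean_def is_mean_def)
  define z where "z = (\<lambda>M. if M \<in> ?T then 2 * y M else 0)"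
  have z: "(\<Sum>M\<in>C. z M * g M) = 2 * (\<Sum>M\<in>?T. y M * g M)" for g
  proof -
    have "(\<Sum>M\<in>C. z M * g M) = (\<Sum>M\<in>?T. z M * g M)"
      by (rule sum.mono_neutral_right[OF finC TC]) (auto simp: z_def)
    then show ?thesis by (simp add: z_def sum_distrib_left mult_ac)
  qed
  have "(\<Sum>M | M \<in> C \<and> v \<in> M. z M) = 1" if v: "v \<in> V" for v
  proof -
    have "(\<Sum>M | M \<in> C \<and> v \<in> M. z M) = (\<Sum>M\<in>C. z M * (if v \<in> M then 1 else 0))"
      using finC by (auto simp: sum.inter_filter intro!: sum.cong)
    also have "\<dots> = (\<Sum>M\<in>?T. y M * mem_sign v M + y M)"
      unfolding z sum_distrib_left by (rule sum.cong) (auto simp: mem_sign_def)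
    also have "\<dots> = L (mem_sign v) + 1" using y(2) by (simp add: sum.distrib y(3))
    finally show ?thesis using L v by (simp add: balanced_mean_def)
  qed
  moreover have "(\<Sum>M\<in>C. z M) = 2" using z[of "\<lambda>_. 1"] y(2) by simp
  moreover have "0 \<le> z M" for M using y(1) by (simp add: z_def)
  ultimately have pack: "fractional_packing V C z" "(\<Sum>M\<in>C. z M) = 2" by (auto simp: fractional_packing_def)
  have "M \<in> core V C" if "M \<in> ?T" "y M \<noteq> 0" for M
  proof -
    have "y M > 0" using that y(1) by (metis order_le_less)
    then show ?thesis using that(1) pack TC unfolding core_def by (auto simp: z_def intro!: exI[of _ z])
  qed
  then have zero: "\<forall>M\<in>?T - core V C. y M = 0" by blast
  have sub: "core V C \<subseteq> ?T" by (rule core_subset_transversals[OF C])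
  have "(\<Sum>M\<in>?T. y M * g M) = (\<Sum>M\<in>core V C. y M * g M)" for g
    by (rule sum.mono_neutral_right[OF finT sub]) (use zero in auto)
  moreover from this[of "\<lambda>_. 1"] have "sum y (core V C) = 1" using y(2) by simp
  moreover have "\<forall>M\<in>core V C. 0 \<le> y M" using y(1) sub by blast
  ultimately show ?thesis unfolding is_mean_def y(3) by (intro exI[of _ y]) auto
qed

section \<open>Balanced simplices in the cube\<close>

text \<open>The point \<open>p\<close> of the cube \<open>{0,1}\<^sup>r\<close> read in \<open>{-1,1}\<^sup>r\<close>.\<close>

definition sign_coord :: "'r::finite \<Rightarrow> real^'r \<Rightarrow> real" where
  "sign_coord i p = 2 * p $ i - 1"

definition balanced_on :: "(real^'r::finite) set \<Rightarrow> ((real^'r \<Rightarrow> real) \<Rightarrow> real) \<Rightarrow> bool" where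
  "balanced_on S L \<longleftrightarrow> is_mean S L \<and> (\<forall>i. L (sign_coord i) = 0)"

text \<open>The condition says that the barycentre is the centre of the cube, and barycentric coordinates
  with respect to affinely independent points are unique.\<close>

lemma balanced_on_unique:
  fixes S :: "(real^'r::finite) set"
  assumes fin: "finite S" and aff: "\<not> affine_dependent S"
    and L: "balanced_on S L" and L': "balanced_on S L'"
  shows "L = L'"
proof -
  obtain y where y: "sum y S = 1" "\<And>g. L g = (\<Sum>p\<in>S. y p * g p)"
    using L by (auto simp: balanced_on_def is_mean_def)
  obtain y' where y': "sum y' S = 1" "\<And>g. L' g = (\<Sum>p\<in>S. y' p * g p)"
    using L' by (auto simp: balanced_on_def is_mean_def)
  have coord: "(\<Sum>p\<in>S. (y p - y' p) * p $ i) = 0" for i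
  proof -
    have "(\<Sum>p\<in>S. y p * (2 * p $ i - 1)) = 0" "(\<Sum>p\<in>S. y' p * (2 * p $ i - 1)) = 0"
      using L L' y(2)[of "sign_coord i"] y'(2)[of "sign_coord i"] by (simp_all add: balanced_on_def sign_coord_def)
    moreover have "(\<Sum>p\<in>S. z p * (2 * p $ i - 1)) = 2 * (\<Sum>p\<in>S. z p * p $ i) - sum z S" for z
      by (simp add: algebra_simps sum_subtractf sum_distrib_left)
    ultimately have "(\<Sum>p\<in>S. y p * p $ i) = (\<Sum>p\<in>S. y' p * p $ i)" using y(1) y'(1) by simp
    then show ?thesis by (simp add: left_diff_distrib sum_subtractf)
  qed
  have "(\<Sum>p\<in>S. (y p - y' p) *\<^sub>R p) = 0"
    unfolding vec_eq_iff by (simp add: coord)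
  moreover have "(\<Sum>p\<in>S. y p - y' p) = 0" using y(1) y'(1) by (simp add: sum_subtractf)
  ultimately have "\<forall>p\<in>S. y p - y' p = 0"
    using aff unfolding affine_dependent_explicit_finite[OF fin] by blast
  then show ?thesis unfolding fun_eq_iff y(2) y'(2) by (auto intro!: sum.cong)
qed

text \<open>The functions \<open>F a\<close> are orthonormal for the weights \<open>y\<close>. Listing the points of \<open>S\<close> among the
  indices \<open>'n\<close>, with zero columns for unused indices, turns orthonormality into \<open>A ** B = mat 1\<close> for square
  matrices. Then \<open>B ** A = mat 1\<close> forbids zero columns and gives the dual relations.\<close>

lemma orthonormal_complete:
  fixes F :: "'n::finite \<Rightarrow> 'b \<Rightarrow> real"
  assumes fin: "finite S" and card: "card S \<le> CARD('n)"
    and orth: "\<And>a b. (\<Sum>p\<in>S. y p * (F a p * F b p)) = (if a = b then 1 else 0)"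
  shows "card S = CARD('n)"
    and "p \<in> S \<Longrightarrow> q \<in> S \<Longrightarrow> y p * (\<Sum>a\<in>UNIV. F a p * F a q) = (if p = q then 1 else 0)"
proof -
  obtain h :: "'b \<Rightarrow> 'n" where h: "inj_on h S"
    using card_le_inj[OF fin, of "UNIV :: 'n set"] card by auto
  let ?g = "inv_into S h"
  define A :: "real^'n^'n" where "A = (\<chi> a c. if c \<in> h ` S then F a (?g c) else 0)"
  define B :: "real^'n^'n" where "B = (\<chi> c a. if c \<in> h ` S then y (?g c) * F a (?g c) else 0)"
  have "(A ** B) $ a $ b = (if a = b then 1 else 0)" for a b
  proof -
    have "(A ** B) $ a $ b = (\<Sum>c\<in>UNIV. if c \<in> h ` S then F a (?g c) * (y (?g c) * F b (?g c)) else 0)"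
      unfolding A_def B_def matrix_matrix_mult_def by (auto intro!: sum.cong)
    also have "\<dots> = (\<Sum>c\<in>h ` S. F a (?g c) * (y (?g c) * F b (?g c)))"
      by (simp add: sum.If_cases)
    also have "\<dots> = (\<Sum>p\<in>S. y p * (F a p * F b p))"
      by (subst sum.reindex[OF h]) (auto simp: inv_into_f_f[OF h] intro!: sum.cong)
    finally show ?thesis using orth by simp
  qed
  then have "A ** B = mat 1" by (simp add: vec_eq_iff mat_def)
  then have BA: "B ** A = mat 1" using matrix_left_right_inverse by blast
  then have BA': "(B ** A) $ c $ d = (if c = d then 1 else 0)" for c d by (simp add: mat_def)
  have "h ` S = UNIV"
  proof (rule ccontr)
    assume "h ` S \<noteq> UNIV"
    then obtain c where "c \<notin> h ` S" by blast
    then have "(B ** A) $ c $ c = 0" unfolding A_def B_def matrix_matrix_mult_def by simp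
    then show False using BA'[of c c] by simp
  qed
  then show "card S = CARD('n)" using card_image[OF h] by simp
  assume pq: "p \<in> S" "q \<in> S"
  have "(B ** A) $ h p $ h q = y p * (\<Sum>a\<in>UNIV. F a p * F a q)"
    unfolding A_def B_def matrix_matrix_mult_def using pq
    by (simp add: inv_into_f_f[OF h] sum_distrib_left mult_ac)
  then show "y p * (\<Sum>a\<in>UNIV. F a p * F a q) = (if p = q then 1 else 0)"
    using BA'[of "h p" "h q"] inj_on_eq_iff[OF h pq] by simp
qed

text \<open>By Parseval the squares of the coefficients of \<open>g\<close> in the orthonormal basis \<open>F\<close> add up to
  1, so exactly one of these integers is nonzero.\<close>

lemma unit_function_is_basis_function:
  fixes F :: "'n::finite \<Rightarrow> 'b \<Rightarrow> real"
  assumes fin: "finite S"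
    and compl: "\<And>p q. p \<in> S \<Longrightarrow> q \<in> S \<Longrightarrow> y p * (\<Sum>a\<in>UNIV. F a p * F a q) = (if p = q then 1 else 0)"
    and unit: "(\<Sum>p\<in>S. y p * (g p * g p)) = 1"
    and coef: "\<And>a. (\<Sum>p\<in>S. y p * (g p * F a p)) \<in> {-1, 0, 1}"
  shows "\<exists>a. (\<Sum>p\<in>S. y p * (g p * F a p)) \<noteq> 0 \<and> (\<forall>p\<in>S. g p = (\<Sum>p\<in>S. y p * (g p * F a p)) * F a p)"
proof -
  define c where "c = (\<lambda>a. \<Sum>p\<in>S. y p * (g p * F a p))"
  have expand: "g q = (\<Sum>a\<in>UNIV. c a * F a q)" if q: "q \<in> S" for q
  proof -
    have "(\<Sum>a\<in>UNIV. c a * F a q) = (\<Sum>a\<in>UNIV. \<Sum>p\<in>S. g p * (y p * (F a p * F a q)))"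
      unfolding c_def sum_distrib_right by (auto intro!: sum.cong)
    also have "\<dots> = (\<Sum>p\<in>S. g p * (y p * (\<Sum>a\<in>UNIV. F a p * F a q)))"
      by (subst sum.swap) (simp add: sum_distrib_left)
    also have "\<dots> = (\<Sum>p\<in>S. if p = q then g p else 0)"
      by (rule sum.cong) (use compl q in auto)
    also have "\<dots> = g q" using fin q by simp
    finally show ?thesis by simp
  qed
  have "1 = (\<Sum>p\<in>S. y p * (g p * (\<Sum>a\<in>UNIV. c a * F a p)))"
    unfolding unit[symmetric] by (rule sum.cong) (use expand in auto)
  also have "\<dots> = (\<Sum>a\<in>UNIV. \<Sum>p\<in>S. c a * (y p * (g p * F a p)))"
    by (subst sum.swap) (simp add: sum_distrib_left mult_ac)
  also have "\<dots> = (\<Sum>a\<in>UNIV. (c a)\<^sup>2)"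
    by (simp add: c_def power2_eq_square flip: sum_distrib_left)
  finally have pars: "(\<Sum>a\<in>UNIV. (c a)\<^sup>2) = 1" by simp
  have c: "c a \<in> {-1, 0, 1}" for a using coef by (simp add: c_def)
  obtain a where a: "c a \<noteq> 0"
  proof (rule ccontr)
    assume "\<not> thesis"
    then have "\<forall>a. c a = 0" using that by blast
    then show False using pars by simp
  qed
  then have "(c a)\<^sup>2 = 1" using c[of a] by auto
  moreover have "(\<Sum>b\<in>UNIV. (c b)\<^sup>2) = (c a)\<^sup>2 + (\<Sum>b\<in>UNIV - {a}. (c b)\<^sup>2)"
    by (rule sum.remove) auto
  ultimately have "(\<Sum>b\<in>UNIV - {a}. (c b)\<^sup>2) = 0" using pars by simp
  then have "\<forall>b\<in>UNIV - {a}. (c b)\<^sup>2 = 0" by (subst (asm) sum_nonneg_eq_0_iff) auto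
  then have z: "c b = 0" if "b \<noteq> a" for b using that by auto
  have "g q = c a * F a q" if "q \<in> S" for q
  proof -
    have "g q = c a * F a q + (\<Sum>b\<in>UNIV - {a}. c b * F b q)"
      unfolding expand[OF that] by (rule sum.remove) auto
    then show ?thesis using z by simp
  qed
  then show ?thesis using a unfolding c_def by blast
qed

lemma prod_sym_diff_sign:
  fixes f :: "'c \<Rightarrow> real"
  assumes "finite A" "finite B" "\<And>x. f x * f x = 1"
  shows "prod f (A - B \<union> (B - A)) = prod f A * prod f B"
proof -
  have "prod f A = prod f (A - B) * prod f (A \<inter> B)"
    using assms(1) by (subst prod.union_disjoint[symmetric]) (auto intro!: prod.cong)
  moreover have "prod f B = prod f (B - A) * prod f (A \<inter> B)"
    using assms(2) by (subst prod.union_disjoint[symmetric]) (auto intro!: prod.cong)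
  moreover have "prod f (A \<inter> B) * prod f (A \<inter> B) = 1"
    using assms(3) by (simp flip: prod.distrib)
  moreover have "prod f (A - B \<union> (B - A)) = prod f (A - B) * prod f (B - A)"
    using assms by (intro prod.union_disjoint) auto
  ultimately show ?thesis by (simp add: mult_ac)
qed

lemma prod_signs_parity:
  fixes f :: "'c \<Rightarrow> nat"
  assumes "finite A" "\<And>x. x \<in> A \<Longrightarrow> f x \<in> {0, 1}"
  shows "(\<Prod>x\<in>A. 1 - 2 * real (f x)) = 1 - 2 * real ((\<Sum>x\<in>A. f x) mod 2)"
  using assms
proof (induction A rule: finite_induct)
  case (insert x A)
  define s where "s = (\<Sum>x\<in>A. f x) mod 2"
  have "f x = 0 \<or> f x = 1" "s = 0 \<or> s = 1" using insert.prems by (auto simp: s_def)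
  moreover have "(\<Sum>x\<in>insert x A. f x) mod 2 = (f x + s) mod 2"
    using insert.hyps by (simp add: s_def mod_add_right_eq)
  moreover have "(\<Prod>x\<in>insert x A. 1 - 2 * real (f x)) = (1 - 2 * real (f x)) * (1 - 2 * real s)"
    using insert by (simp add: s_def)
  ultimately show ?case by (elim disjE) simp_all
qed simp

lemma card_binary_vectors: "finite (binary_vectors k)" "card (binary_vectors k) = 2 ^ k"
  by (auto simp: binary_vectors_def card_PiE numeral_2_eq_2 intro!: finite_PiE)

text \<open>The functions \<open>G i\<close> together with 1 form a group of exponent two, that is, a vector space over the
  two-element field. For a basis \<open>G (\<beta> 0), \<dots>, G (\<beta> (k - 1))\<close>, the vector \<open>\<sigma> x\<close> holds the
  coordinates of \<open>G x\<close>; these vectors run through all nonzero ones. The basis is a maximal set \<open>B\<close> such that no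
  product over a nonempty subset is trivial on \<open>S\<close>.\<close>

lemma sign_group_coordinates:
  fixes G :: "'r::finite \<Rightarrow> 'b \<Rightarrow> real"
  assumes val: "\<And>i p. p \<in> S \<Longrightarrow> G i p * G i p = 1"
    and nontriv: "\<And>i. \<exists>p\<in>S. G i p \<noteq> 1"
    and distinct: "\<And>i j. i \<noteq> j \<Longrightarrow> \<exists>p\<in>S. G i p \<noteq> G j p"
    and closed: "\<And>i j. i \<noteq> j \<Longrightarrow> \<exists>l. \<forall>p\<in>S. G i p * G j p = G l p"
  shows "\<exists>k \<sigma> \<beta>. k \<ge> 1 \<and> bij_betw \<sigma> UNIV (PG_columns k) \<and>
    (\<forall>x. \<forall>p\<in>S. G x p = (\<Prod>j<k. if \<sigma> x j = 1 then G (\<beta> j) p else 1))"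
proof -
  define P where "P = (\<lambda>A p. \<Prod>i\<in>A. G i p)"
  have sq: "P A p * P A p = 1" if "p \<in> S" for A p
    unfolding P_def using val[OF that] by (simp flip: prod.distrib)
  have Pclosed: "(\<forall>p\<in>S. P A p = 1) \<or> (\<exists>l. \<forall>p\<in>S. P A p = G l p)" for A
  proof (induction A rule: finite_induct[OF finite])
    case 1
    then show ?case by (simp add: P_def)
  next
    case (2 x A)
    have ins: "P (insert x A) p = G x p * P A p" for p using 2 by (simp add: P_def)
    show ?case
    proof (cases "\<forall>p\<in>S. P A p = 1")
      case True
      then show ?thesis by (intro disjI2 exI[of _ x]) (simp add: ins)
    next
      case False
      then obtain l where l: "\<forall>p\<in>S. P A p = G l p" using 2 by blast
      show ?thesis
      proof (cases "x = l")
        case True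
        have "P (insert x A) p = 1" if "p \<in> S" for p
          unfolding ins using l val[OF that] True that by simp
        then show ?thesis by blast
      next
        case False
        then obtain m where "\<forall>p\<in>S. G x p * G l p = G m p" using closed by blast
        then show ?thesis using l by (intro disjI2 exI[of _ m]) (simp add: ins)
      qed
    qed
  qed
  define indep where "indep = (\<lambda>B. \<forall>A\<subseteq>B. A \<noteq> {} \<longrightarrow> (\<exists>p\<in>S. P A p \<noteq> 1))"
  have "{} \<in> {B. indep B}" by (auto simp: indep_def)
  then obtain B where B: "indep B" and Bmax: "\<And>B'. indep B' \<Longrightarrow> B \<subseteq> B' \<Longrightarrow> B = B'"
    using finite_has_maximal[of "{B. indep B}"] by (metis (mono_tags, lifting) empty_iff finite mem_Collect_eq)
  have inj: "A = A'" if AB: "A \<subseteq> B" "A' \<subseteq> B" and eq: "\<forall>p\<in>S. P A p = P A' p" for A A'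
  proof -
    have "P (A - A' \<union> (A' - A)) p = 1" if "p \<in> S" for p
      unfolding P_def using prod_sym_diff_sign[of A A' "\<lambda>i. G i p"] val[OF that] eq sq[OF that] that
      by (simp add: P_def)
    moreover have "A - A' \<union> (A' - A) \<subseteq> B" using AB by blast
    ultimately have "A - A' \<union> (A' - A) = {}" using B unfolding indep_def by blast
    then show ?thesis by blast
  qed
  have "\<exists>A\<subseteq>B. \<forall>p\<in>S. G x p = P A p" for x
  proof (cases "x \<in> B")
    case True
    then show ?thesis by (intro exI[of _ "{x}"]) (simp add: P_def)
  next
    case False
    then have "\<not> indep (insert x B)" using Bmax[of "insert x B"] by blast
    then obtain A where A: "A \<subseteq> insert x B" "A \<noteq> {}" "\<forall>p\<in>S. P A p = 1" unfolding indep_def by blast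
    \<comment> \<open>By maximality of \<open>B\<close> the trivial product must involve \<open>x\<close>, and can be solved for \<open>G x\<close>.\<close>
    have "x \<in> A" using A B unfolding indep_def by blast
    then have "G x p * P (A - {x}) p = 1" if "p \<in> S" for p
      using A(3) that prod.remove[of A x "\<lambda>i. G i p"] by (simp add: P_def)
    then have "G x p = P (A - {x}) p" if "p \<in> S" for p
    proof -
      have "G x p = (G x p * P (A - {x}) p) * P (A - {x}) p"
        using sq[OF that, of "A - {x}"] by (simp add: mult.assoc)
      then show ?thesis using \<open>\<And>p. p \<in> S \<Longrightarrow> G x p * P (A - {x}) p = 1\<close>[OF that] by simp
    qed
    then show ?thesis using A(1) by (intro exI[of _ "A - {x}"]) blast
  qed
  then obtain \<alpha> where \<alpha>: "\<And>x. \<alpha> x \<subseteq> B" "\<And>x p. p \<in> S \<Longrightarrow> G x p = P (\<alpha> x) p" by metis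
  have \<alpha>inj: "x = y" if "\<alpha> x = \<alpha> y" for x y using distinct[of x y] that \<alpha>(2) by metis
  have \<alpha>ne: "\<alpha> x \<noteq> {}" for x using nontriv[of x] \<alpha>(2)[of _ x] by (auto simp: P_def)
  have \<alpha>surj: "\<exists>x. \<alpha> x = A" if A: "A \<subseteq> B" "A \<noteq> {}" for A
  proof -
    obtain l where "\<forall>p\<in>S. P A p = G l p" using Pclosed[of A] B A unfolding indep_def by blast
    then have "\<alpha> l = A" using inj[OF \<alpha>(1) A(1), of l] \<alpha>(2) by simp
    then show ?thesis by blast
  qed
  define k where "k = card B"
  obtain \<beta> where \<beta>: "bij_betw \<beta> {..<k} B"
    using ex_bij_betw_nat_finite[of B] by (auto simp: k_def atLeast0LessThan)
  define \<sigma> where "\<sigma> = (\<lambda>x. \<lambda>j\<in>{..<k}. if \<beta> j \<in> \<alpha> x then 1 else 0 :: nat)"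
  have \<beta>ex: "\<exists>j<k. \<beta> j = b" if "b \<in> B" for b using \<beta> that by (auto simp: bij_betw_def)
  have "\<sigma> x \<in> PG_columns k" for x
  proof -
    obtain b where "b \<in> \<alpha> x" using \<alpha>ne by blast
    then obtain j where "j < k" "\<beta> j \<in> \<alpha> x" using \<alpha>(1) \<beta>ex by blast
    then have "\<exists>j<k. \<sigma> x j \<noteq> 0" by (auto simp: \<sigma>_def)
    moreover have "\<sigma> x \<in> binary_vectors k" by (auto simp: binary_vectors_def \<sigma>_def)
    ultimately show ?thesis by (simp add: PG_columns_def)
  qed
  moreover have "inj \<sigma>"
  proof (rule injI)
    fix x y assume eq: "\<sigma> x = \<sigma> y"
    have "\<beta> j \<in> \<alpha> x \<longleftrightarrow> \<beta> j \<in> \<alpha> y" if "j < k" for j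
      using fun_cong[OF eq, of j] that by (auto simp: \<sigma>_def split: if_splits)
    then have "\<alpha> x = \<alpha> y" using \<alpha>(1)[of x] \<alpha>(1)[of y] \<beta>ex by (metis subset_antisym subset_eq)
    then show "x = y" by (rule \<alpha>inj)
  qed
  moreover have "\<exists>x. \<sigma> x = c" if c: "c \<in> PG_columns k" for c
  proof -
    have cb: "c \<in> {..<k} \<rightarrow>\<^sub>E {0, 1}" and ex: "\<exists>j<k. c j \<noteq> 0"
      using c by (auto simp: PG_columns_def binary_vectors_def)
    obtain j0 where j0: "j0 < k" "c j0 \<noteq> 0" using ex by blast
    then have "c j0 = 1" using PiE_mem[OF cb, of j0] by auto
    let ?A = "\<beta> ` {j. j < k \<and> c j = 1}"
    have "?A \<subseteq> B" using \<beta> by (auto simp: bij_betw_def)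
    moreover have "?A \<noteq> {}" using j0 \<open>c j0 = 1\<close> by blast
    ultimately obtain x where x: "\<alpha> x = ?A" using \<alpha>surj by blast
    have "\<sigma> x j = c j" for j
    proof (cases "j < k")
      case True
      then have "\<beta> j \<in> ?A \<longleftrightarrow> c j = 1" using \<beta> by (auto simp: bij_betw_def inj_on_def)
      moreover have "c j = 0 \<or> c j = 1" using cb True by (auto simp: PiE_iff)
      ultimately show ?thesis using True x by (auto simp: \<sigma>_def)
    next
      case False
      then show ?thesis using cb by (auto simp: \<sigma>_def PiE_iff extensional_def)
    qed
    then show ?thesis by blast
  qed
  ultimately have "bij_betw \<sigma> UNIV (PG_columns k)" unfolding bij_betw_def by blast
  moreover have "k \<ge> 1"
  proof -
    have "B \<noteq> {}" using \<alpha>(1) \<alpha>ne by blast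
    then show ?thesis by (simp add: k_def Suc_le_eq card_gt_0_iff)
  qed
  moreover have "G x p = (\<Prod>j<k. if \<sigma> x j = 1 then G (\<beta> j) p else 1)" if p: "p \<in> S" for x p
  proof -
    have "G x p = (\<Prod>i\<in>\<alpha> x. G i p)" using \<alpha>(2)[OF p, of x] unfolding P_def .
    also have "\<dots> = (\<Prod>i\<in>B. if i \<in> \<alpha> x then G i p else 1)"
      using \<alpha>(1)[of x] by (intro prod.mono_neutral_cong_left) auto
    also have "\<dots> = (\<Prod>j<k. if \<beta> j \<in> \<alpha> x then G (\<beta> j) p else 1)"
      by (rule prod.reindex_bij_betw[OF \<beta>, symmetric])
    also have "\<dots> = (\<Prod>j<k. if \<sigma> x j = 1 then G (\<beta> j) p else 1)"
      by (rule prod.cong) (auto simp: \<sigma>_def)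
    finally show ?thesis .
  qed
  ultimately show ?thesis by (intro exI[of _ k] exI[of _ \<sigma>] exI[of _ \<beta>] conjI allI ballI)
qed

text \<open>By uniqueness the various balanced means in the assumptions coincide, so the coordinate signs and the
  constant 1 are an orthonormal basis of the functions on \<open>S\<close> and are closed under products up to sign.
  Twisting a point \<open>p0\<close> of \<open>S\<close> to the origin removes the signs.\<close>

lemma balanced_simplex_is_cocycle:
  fixes S :: "(real^'r::finite) set"
  assumes fin: "finite S" and cube: "\<And>p i. p \<in> S \<Longrightarrow> p $ i = 0 \<or> p $ i = 1"
    and aff: "\<not> affine_dependent S"
    and ex: "\<exists>L. balanced_on S L"
    and pair: "\<And>i j. i \<noteq> j \<Longrightarrow> \<exists>L. balanced_on S L \<and> L (\<lambda>p. sign_coord i p * sign_coord j p) = 0"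
    and triple: "\<And>i j k. i \<noteq> j \<Longrightarrow> i \<noteq> k \<Longrightarrow> \<exists>L. balanced_on S L \<and>
       (L (\<lambda>p. sign_coord j p * sign_coord k p) = 0 \<longrightarrow>
        L (\<lambda>p. sign_coord i p * (sign_coord j p * sign_coord k p)) \<in> {-1, 0, 1})"
  shows "\<exists>k\<ge>1. cube_isomorphic S (PG_columns k) (cocycle_PG k)"
proof -
  let ?f = "sign_coord :: 'r \<Rightarrow> real^'r \<Rightarrow> real"
  obtain L where L: "balanced_on S L" using ex by (elim exE)
  have uniq: "L' = L" if "balanced_on S L'" for L' by (rule balanced_on_unique[OF fin aff that L])
  obtain y where y: "sum y S = 1" "\<And>g. L g = (\<Sum>p\<in>S. y p * g p)"
    using L by (auto simp: balanced_on_def is_mean_def)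
  have mean: "is_mean S L" and zero: "L (?f i) = 0" for i using L by (auto simp: balanced_on_def)
  have pair0: "L (\<lambda>p. ?f i p * ?f j p) = 0" if ij: "i \<noteq> j" for i j 
  proof -
    obtain L' where L': "balanced_on S L'" "L' (\<lambda>p. ?f i p * ?f j p) = 0"
      using pair[OF ij] by (elim exE conjE)
    show ?thesis by (rule L'(2)[unfolded uniq[OF L'(1)]])
  qed
  have triple0: "L (\<lambda>p. ?f i p * (?f j p * ?f k p)) \<in> {-1, 0, 1}" if ijk: "i \<noteq> j" "i \<noteq> k" "j \<noteq> k" for i j k
  proof -
    obtain L' where L': "balanced_on S L'" "L' (\<lambda>p. ?f j p * ?f k p) = 0 \<longrightarrow>
        L' (\<lambda>p. ?f i p * (?f j p * ?f k p)) \<in> {-1, 0, 1}"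
      using triple[OF ijk(1,2)] by (elim exE conjE)
    show ?thesis by (rule mp[OF L'(2)[unfolded uniq[OF L'(1)]] pair0[OF ijk(3)]])
  qed
  have sq: "?f i p * ?f i p = 1" if "p \<in> S" for i p using cube[OF that, of i] by (auto simp: sign_coord_def)
  \<comment> \<open>The index \<open>None\<close> stands for the constant function, so the index type has \<open>r + 1\<close> elements.\<close>
  define F where "F = (\<lambda>a p. case a of None \<Rightarrow> 1 | Some i \<Rightarrow> ?f i p)"
  have F: "F None p = 1" "F (Some i) p = ?f i p" for i p by (simp_all add: F_def)
  have one: "L (\<lambda>p. ?f i p * ?f i p) = 1" for i by (rule mean_const[OF mean]) (rule sq)
  have orth: "(\<Sum>p\<in>S. y p * (F a p * F b p)) = (if a = b then 1 else 0)" for a b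
  proof (cases a; cases b)
    fix i j assume "a = Some i" "b = Some j"
    then show ?thesis using pair0[of i j] one[of i] unfolding y(2) by (cases "i = j") (simp_all add: F)
  qed (use zero y in \<open>simp_all add: F\<close>)
  have "int (card S) = aff_dim S + 1" using aff_dim_affine_independent[OF aff] by simp
  moreover have "aff_dim S \<le> int DIM(real^'r)" by (rule aff_dim_le_DIM)
  ultimately have "card S \<le> CARD('r option)" by simp
  note complete = orthonormal_complete[OF fin this orth]
  have closed: "\<exists>l c. \<forall>p\<in>S. ?f i p * ?f j p = c * ?f l p" if ij: "i \<noteq> j" for i j
  proof -
    have coef: "(\<Sum>p\<in>S. y p * (?f i p * ?f j p * F a p)) \<in> {-1, 0, 1}" for a
    proof (cases a)
      case None
      then show ?thesis using pair0[OF ij] unfolding y(2) by (simp add: F)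
    next
      case (Some k)
      have "(\<Sum>p\<in>S. y p * (?f i p * ?f j p * F a p)) = L (\<lambda>p. ?f i p * ?f j p * ?f k p)"
        unfolding y(2) Some by (simp add: F)
      moreover have "L (\<lambda>p. ?f i p * ?f j p * ?f k p) \<in> {-1, 0, 1}"
      proof (cases "k = i \<or> k = j")
        case True
        then have "L (\<lambda>p. ?f i p * ?f j p * ?f k p) = L (?f (if k = i then j else i))"
          using sq by (intro mean_cong[OF mean]) (auto simp: mult_ac)
        then show ?thesis using zero by simp
      next
        case False
        then show ?thesis using triple0[of i j k] ij by (auto simp: mult.assoc)
      qed
      ultimately show ?thesis by simp
    qed
    have "L (\<lambda>p. ?f i p * ?f j p * (?f i p * ?f j p)) = 1"
    proof (rule mean_const[OF mean])
      fix p assume "p \<in> S"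
      then have "?f i p * ?f i p * (?f j p * ?f j p) = 1" using sq by simp
      then show "?f i p * ?f j p * (?f i p * ?f j p) = 1" by (simp add: mult_ac)
    qed
    then have unit: "(\<Sum>p\<in>S. y p * (?f i p * ?f j p * (?f i p * ?f j p))) = 1" by (simp only: y(2))
    define c where "c = (\<lambda>a. \<Sum>p\<in>S. y p * (?f i p * ?f j p * F a p))"
    have "\<exists>a. c a \<noteq> 0 \<and> (\<forall>p\<in>S. ?f i p * ?f j p = c a * F a p)"
      unfolding c_def
      by (rule unit_function_is_basis_function[OF fin]) (rule complete(2), assumption+, rule unit, rule coef)
    then obtain a where a: "c a \<noteq> 0" "\<forall>p\<in>S. ?f i p * ?f j p = c a * F a p" by blast
    have "a \<noteq> None"
    proof
      assume "a = None"
      then show False using a(1) pair0[OF ij] unfolding y(2) c_def by (simp add: F)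
    qed
    then obtain l where "a = Some l" by blast
    then have "\<forall>p\<in>S. ?f i p * ?f j p = c a * ?f l p" using a(2) by (simp add: F)
    then show ?thesis by blast
  qed
  have "S \<noteq> {}" using y(1) by auto
  then obtain p0 where p0: "p0 \<in> S" by blast
  define G where "G = (\<lambda>i p. ?f i p * ?f i p0)"
  have G2: "G i p * G i p = 1" if "p \<in> S" for i p
  proof -
    have "G i p * G i p = (?f i p * ?f i p) * (?f i p0 * ?f i p0)" by (simp add: G_def mult_ac)
    then show ?thesis using sq that p0 by simp
  qed
  have fG: "?f i p = G i p * ?f i p0" for i p using sq[OF p0, of i] by (simp add: G_def mult.assoc)
  have f0: "?f i p0 \<noteq> 0" for i using sq[OF p0, of i] by auto
  have nontriv: "\<exists>p\<in>S. G i p \<noteq> 1" for i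
  proof (rule ccontr)
    assume "\<not> ?thesis"
    then have one: "G i p = 1" if "p \<in> S" for p using that by blast
    have "L (?f i) = ?f i p0"
    proof (rule mean_const[OF mean])
      fix p assume "p \<in> S"
      show "?f i p = ?f i p0" using fG[of i p] one[OF \<open>p \<in> S\<close>] by simp
    qed
    then show False using zero f0 by simp
  qed
  have distinct: "\<exists>p\<in>S. G i p \<noteq> G j p" if "i \<noteq> j" for i j
  proof (rule ccontr)
    assume "\<not> ?thesis"
    then have eq: "G i p = G j p" if "p \<in> S" for p using that by blast
    have "L (\<lambda>p. ?f i p * ?f j p) = ?f i p0 * ?f j p0"
    proof (rule mean_const[OF mean])
      fix p assume p: "p \<in> S"
      have "?f i p * ?f j p = (G i p * G j p) * (?f i p0 * ?f j p0)"
        using fG[of i p] fG[of j p] by simp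
      then show "?f i p * ?f j p = ?f i p0 * ?f j p0" using eq[OF p] G2[OF p, of j] by simp
    qed
    then show False using pair0[OF that] f0 by simp
  qed
  have Gclosed: "\<exists>l. \<forall>p\<in>S. G i p * G j p = G l p" if ij: "i \<noteq> j" for i j
  proof -
    obtain l c where l: "\<And>p. p \<in> S \<Longrightarrow> ?f i p * ?f j p = c * ?f l p" using closed[OF ij] by blast
    have c: "c * c = 1"
    proof -
      have "(c * c) * (?f l p0 * ?f l p0) = (?f i p0 * ?f i p0) * (?f j p0 * ?f j p0)"
        using l[OF p0] by (metis mult.assoc mult.commute)
      then show ?thesis using sq[OF p0] by simp
    qed
    have "G i p * G j p = G l p" if "p \<in> S" for p
    proof -
      have "G i p * G j p = (?f i p * ?f j p) * (?f i p0 * ?f j p0)" by (simp add: G_def mult_ac)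
      also have "\<dots> = (c * c) * (?f l p * ?f l p0)" unfolding l[OF that] l[OF p0] by (simp add: mult_ac)
      finally show ?thesis using c by (simp add: G_def)
    qed
    then show ?thesis by blast
  qed
  have "\<exists>k \<sigma> \<beta>. k \<ge> 1 \<and> bij_betw \<sigma> UNIV (PG_columns k) \<and>
    (\<forall>x. \<forall>p\<in>S. G x p = (\<Prod>j<k. if \<sigma> x j = 1 then G (\<beta> j) p else 1))"
    by (rule sign_group_coordinates[of S G]) (rule G2 nontriv distinct Gclosed, assumption?)+
  then obtain k and \<sigma> :: "'r \<Rightarrow> nat \<Rightarrow> nat" and \<beta> :: "nat \<Rightarrow> 'r" where k: "k \<ge> 1"
    and \<sigma>: "bij_betw \<sigma> UNIV (PG_columns k)"
    and G\<sigma>': "\<forall>x. \<forall>p\<in>S. G x p = (\<Prod>j<k. if \<sigma> x j = 1 then G (\<beta> j) p else 1)"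
    by (elim exE conjE)
  have G\<sigma>: "G x p = (\<Prod>j<k. if \<sigma> x j = 1 then G (\<beta> j) p else 1)" if "p \<in> S" for x p
    using G\<sigma>' that by blast
  define \<Psi> where "\<Psi> = (\<lambda>q. \<chi> i. if i \<in> {i. p0 $ i = 1} then 1 - real (q (\<sigma> i)) else real (q (\<sigma> i :: nat \<Rightarrow> nat) :: nat))"
  have "S \<subseteq> \<Psi> ` cocycle_PG k"
  proof
    fix p assume p: "p \<in> S"
    \<comment> \<open>The values of \<open>p\<close> on the basis determine the row combination producing \<open>p\<close>.\<close>
    define z where "z = (\<lambda>j\<in>{..<k}. if G (\<beta> j) p = 1 then 0 else 1 :: nat)"
    define q where "q = (\<lambda>c\<in>PG_columns k. (\<Sum>j<k. c j * z j) mod 2)"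
    have "z \<in> binary_vectors k" by (auto simp: z_def binary_vectors_def)
    then have q: "q \<in> cocycle_PG k" unfolding cocycle_PG_def q_def by blast
    have Gq: "G x p = 1 - 2 * real (q (\<sigma> x))" for x
    proof -
      have \<sigma>x: "\<sigma> x \<in> PG_columns k" using \<sigma> by (auto simp: bij_betw_def)
      then have bin: "\<sigma> x j = 0 \<or> \<sigma> x j = 1" if "j < k" for j
        using that by (auto simp: PG_columns_def binary_vectors_def PiE_iff)
      have "G x p = (\<Prod>j<k. 1 - 2 * real (\<sigma> x j * z j))"
        unfolding G\<sigma>[OF p, of x]
      proof (rule prod.cong)
        fix j assume j: "j \<in> {..<k}"
        have "G (\<beta> j) p = 1 \<or> G (\<beta> j) p = -1" using G2[OF p, of "\<beta> j"] by (simp add: square_eq_1_iff)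
        then show "(if \<sigma> x j = 1 then G (\<beta> j) p else 1) = 1 - 2 * real (\<sigma> x j * z j)"
          using bin[of j] j by (auto simp: z_def)
      qed simp
      also have "\<dots> = 1 - 2 * real ((\<Sum>j<k. \<sigma> x j * z j) mod 2)"
        by (rule prod_signs_parity) (use bin in \<open>auto simp: z_def\<close>)
      also have "\<dots> = 1 - 2 * real (q (\<sigma> x))" using \<sigma>x by (simp add: q_def)
      finally show ?thesis .
    qed
    have "p $ x = \<Psi> q $ x" for x
      using Gq[of x] cube[OF p, of x] cube[OF p0, of x] by (auto simp: \<Psi>_def G_def sign_coord_def)
    then have "p = \<Psi> q" by (simp add: vec_eq_iff)
    then show "p \<in> \<Psi> ` cocycle_PG k" using q by blast
  qed
  moreover have "cocycle_PG k = (\<lambda>z. \<lambda>c\<in>PG_columns k. (\<Sum>j<k. c j * z j) mod 2) ` binary_vectors k"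
    unfolding cocycle_PG_def by blast
  then have cc: "finite (cocycle_PG k)" "card (cocycle_PG k) \<le> 2 ^ k"
    using card_binary_vectors[of k] card_image_le[of "binary_vectors k"] by auto
  \<comment> \<open>Equality by counting: the basis property gives \<open>card S = CARD('r) + 1 = 2 ^ k\<close>.\<close>
  moreover have "card (\<Psi> ` cocycle_PG k) \<le> card S"
  proof -
    have "CARD('r) = 2 ^ k - 1" using bij_betw_same_card[OF \<sigma>] card_PG_columns by simp
    then have "card S = 2 ^ k" using complete(1) by simp
    then show ?thesis using card_image_le[OF cc(1), of \<Psi>] cc(2) by simp
  qed
  ultimately have "S = \<Psi> ` cocycle_PG k" by (intro card_seteq) auto
  then have "cube_isomorphic S (PG_columns k) (cocycle_PG k)"
    unfolding cube_isomorphic_def \<Psi>_def using \<sigma> by blast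
  then show ?thesis using k by blast
qed

section \<open>The set core\<close>

text \<open>Along an edge both membership in \<open>M\<close> and membership in \<open>W i\<close> alternate, so one
  representative \<open>w i \<in> W i\<close> per component decides which colour class \<open>M\<close> contains.\<close>

lemma setcore_as_image:
  fixes U W :: "'r::finite \<Rightarrow> 'a set"
  assumes C: "clutter V C" and cl: "clean V C" and T: "tangled V C"
    and comps: "component_bipartitions V C U W"
  obtains w :: "'r \<Rightarrow> 'a" where "\<And>i. w i \<in> V" "\<And>i j. i \<noteq> j \<Longrightarrow> w j \<in> off_component V (covers V C) (w i)"
    "setcore V C U W = (\<lambda>M. \<chi> i. if w i \<in> M then 1 else 0) ` core V C"
proof -
  let ?K = "covers V C"
  let ?E = "edges ?K"
  note TK = tangled_covers_covers(1)[OF C cl T] and E = tangled_covers_covers(2)[OF C cl T]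
  have clK: "clean_covers V ?K" using TK by (simp add: tangled_covers_def)
  let ?r = "{(u, v). u \<in> V \<and> v \<in> V \<and> (u, v) \<in> ?E\<^sup>*}"
  have G: "G_components V C = V // ?r" unfolding G_components_def E ..
  have comp_eq: "?r `` {v} = ?E\<^sup>* `` {v}" if "v \<in> V" for v
    using component_subset[OF clK that] that by auto
  have bij: "bij_betw (\<lambda>i. U i \<union> W i) UNIV (V // ?r)" and disj: "\<And>i. U i \<inter> W i = {}"
    and split: "\<And>i e. e \<in> minimum_covers V C \<Longrightarrow> e \<subseteq> U i \<union> W i \<Longrightarrow> card (e \<inter> U i) = 1 \<and> card (e \<inter> W i) = 1"
    using comps unfolding component_bipartitions_def G by auto
  have symE: "sym ?E" by (auto simp: sym_def intro: edges_sym)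
  have comp: "\<exists>x\<in>V. U i \<union> W i = ?E\<^sup>* `` {x}" for i
  proof -
    have "U i \<union> W i \<in> V // ?r" using bij by (auto simp: bij_betw_def)
    then show ?thesis using comp_eq by (auto simp: quotient_def)
  qed
  have comp': "U i \<union> W i = ?E\<^sup>* `` {x}" if "x \<in> U i \<union> W i" for i x
  proof -
    obtain z where z: "U i \<union> W i = ?E\<^sup>* `` {z}" using comp by blast
    then have zx: "(z, x) \<in> ?E\<^sup>*" using that by blast
    then have xz: "(x, z) \<in> ?E\<^sup>*" using symE by (meson sym_rtrancl symD)
    show ?thesis unfolding z using rtrancl_trans[OF zx] rtrancl_trans[OF xz] by blast
  qed
  have CV: "U i \<union> W i \<subseteq> V" for i using comp[of i] component_subset[OF clK] by blast
  have alt: "y \<in> U i \<union> W i \<and> (y \<in> W i \<longleftrightarrow> x \<notin> W i)" if x: "x \<in> U i \<union> W i" and xy: "(x, y) \<in> ?E" for x y i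
  proof -
    have y: "y \<in> U i \<union> W i" using comp'[OF x] xy by auto
    have "{x, y} \<in> minimum_covers V C" using xy E by blast
    then have c: "card ({x, y} \<inter> U i) = 1 \<and> card ({x, y} \<inter> W i) = 1" by (rule split) (use x y in auto)
    have "x \<noteq> y" using xy TK by (auto simp: tangled_covers_def no_small_def edges_def)
    have "\<not> (x \<in> W i \<and> y \<in> W i)"
    proof
      assume "x \<in> W i \<and> y \<in> W i"
      then have "{x, y} \<inter> W i = {x, y}" by auto
      then show False using c \<open>x \<noteq> y\<close> by simp
    qed
    moreover have "x \<in> W i \<or> y \<in> W i"
    proof (rule ccontr)
      assume "\<not> ?thesis"
      then have "{x, y} \<inter> W i = {}" by auto
      then show False using c by simp
    qed
    ultimately show ?thesis using y by blast
  qed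
  have "\<exists>w. w \<in> W i" for i
  proof -
    obtain x where x: "x \<in> V" "U i \<union> W i = ?E\<^sup>* `` {x}" using comp by blast
    then obtain y where "(x, y) \<in> ?E" using tangled_neighbour[OF TK] by metis
    then show ?thesis using alt[of x i y] x(2) by blast
  qed
  then obtain w where w: "\<And>i. w i \<in> W i" by metis
  have wV: "w i \<in> V" for i using w CV by blast
  have off_component: "w j \<in> off_component V ?K (w i)" if "i \<noteq> j" for i j
  proof (rule ccontr)
    assume "w j \<notin> off_component V ?K (w i)"
    then have "w j \<in> U i \<union> W i" using wV comp'[of "w i" i] w by (auto simp: off_component_def)
    then have "U i \<union> W i = U j \<union> W j" using comp'[of "w j" i] comp'[of "w j" j] w by blast
    then show False using bij that by (auto simp: bij_betw_def inj_on_def)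
  qed
  have key: "(M \<inter> (U i \<union> W i) = U i \<and> p $ i = 0) \<or> (M \<inter> (U i \<union> W i) = W i \<and> p $ i = 1)
     \<longleftrightarrow> p $ i = (if w i \<in> M then 1 else 0)"
    if M: "M \<in> core V C" for M i and p :: "real^'r"
  proof -
    have MT: "M \<in> transversals V ?K" using M core_subset_transversals[OF C] by blast
    have "x \<in> U i \<union> W i \<and> ((x \<in> M \<longleftrightarrow> x \<in> W i) \<longleftrightarrow> w i \<in> M)" if "(w i, x) \<in> ?E\<^sup>*" for x
      using that
    proof induction
      case base
      then show ?case using w by blast
    next
      case (step y z)
      then show ?case using alt[of y i z] MT by (auto simp: transversals_def)
    qed
    then have x: "(x \<in> M \<longleftrightarrow> x \<in> W i) \<longleftrightarrow> w i \<in> M" if "x \<in> U i \<union> W i" for x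
      using that comp'[of "w i" i] w by auto
    show ?thesis
    proof (cases "w i \<in> M")
      case True
      then have "M \<inter> (U i \<union> W i) = W i" using x by blast
      moreover have "W i \<noteq> U i" using w disj[of i] by blast
      ultimately show ?thesis using True by auto
    next
      case False
      then have "M \<inter> (U i \<union> W i) = U i" using x disj[of i] by blast
      moreover have "U i \<noteq> W i" using w disj[of i] by blast
      ultimately show ?thesis using False by auto
    qed
  qed
  have "setcore V C U W = (\<lambda>M. \<chi> i. if w i \<in> M then 1 else 0) ` core V C"
  proof (rule set_eqI)
    fix p
    have "p \<in> setcore V C U W \<longleftrightarrow> (\<exists>M\<in>core V C. \<forall>i. p $ i = (if w i \<in> M then 1 else 0))"
      unfolding setcore_def using key by auto
    also have "\<dots> \<longleftrightarrow> p \<in> (\<lambda>M. \<chi> i. if w i \<in> M then 1 else 0) ` core V C"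
      by (auto simp: vec_eq_iff image_iff)
    finally show "p \<in> setcore V C U W \<longleftrightarrow> p \<in> (\<lambda>M. \<chi> i. if w i \<in> M then 1 else 0) ` core V C" .
  qed
  then show thesis using that wV off_component by blast
qed

text \<open>The means over the core are transported to the set core; the coordinate signs are the
  membership signs of the representatives.\<close>

lemma setcore_means:
  fixes U W :: "'r::finite \<Rightarrow> 'a set"
  assumes C: "clutter V C" and cl: "clean V C" and T: "tangled V C"
    and comps: "component_bipartitions V C U W"
  shows "finite (setcore V C U W)" "p \<in> setcore V C U W \<Longrightarrow> p $ i = 0 \<or> p $ i = 1"
    "\<exists>L. balanced_on (setcore V C U W) L"
    "i \<noteq> j \<Longrightarrow> \<exists>L. balanced_on (setcore V C U W) L \<and> L (\<lambda>p. sign_coord i p * sign_coord j p) = 0"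
    "i \<noteq> j \<Longrightarrow> i \<noteq> k \<Longrightarrow> \<exists>L. balanced_on (setcore V C U W) L \<and>
       (L (\<lambda>p. sign_coord j p * sign_coord k p) = 0 \<longrightarrow>
        L (\<lambda>p. sign_coord i p * (sign_coord j p * sign_coord k p)) \<in> {-1, 0, 1})"
proof -
  let ?K = "covers V C"
  note TK = tangled_covers_covers(1)[OF C cl T]
  obtain w :: "'r \<Rightarrow> 'a" where w: "\<And>i. w i \<in> V" "\<And>i j. i \<noteq> j \<Longrightarrow> w j \<in> off_component V ?K (w i)"
    and S: "setcore V C U W = (\<lambda>M. \<chi> i. if w i \<in> M then 1 else 0) ` core V C" (is "?S = ?h ` _")
    using setcore_as_image[OF C cl T comps] by blast
  have fin: "finite (core V C)"
    using clutter_finite_members[OF C] by (simp add: core_def)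
  show "finite ?S" "p \<in> ?S \<Longrightarrow> p $ i = 0 \<or> p $ i = 1" using fin by (auto simp: S)
  have sc: "sign_coord l (?h M) = mem_sign (w l) M" for l M by (simp add: sign_coord_def mem_sign_def)
  have push: "balanced_on ?S (\<lambda>g. L (\<lambda>M. g (?h M)))" if L: "balanced_mean V ?K L" for L
  proof -
    have "is_mean ?S (\<lambda>g. L (\<lambda>M. g (?h M)))"
      by (rule mean_map[OF balanced_mean_core[OF C TK L] fin]) (use fin S in auto)
    moreover have "L (\<lambda>M. sign_coord l (?h M)) = 0" for l
    proof -
      have "L (\<lambda>M. mem_sign (w l) M) = 0" using L w(1) by (simp add: balanced_mean_def)
      then show ?thesis unfolding sc .
    qed
    ultimately show ?thesis by (simp add: balanced_on_def)
  qed
  obtain L where "balanced_mean V ?K L" using balanced_mean_exists[OF TK] by (elim exE)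
  then show "\<exists>L. balanced_on ?S L" using push by blast
  show "\<exists>L. balanced_on ?S L \<and> L (\<lambda>p. sign_coord i p * sign_coord j p) = 0" if ij: "i \<noteq> j"
  proof -
    obtain L where L: "balanced_mean V ?K L" "L (\<lambda>M. mem_sign (w i) M * mem_sign (w j) M) = 0"
      using pair_mean[OF TK w(1)[of i] w(2)[OF ij]] by (elim exE conjE)
    show ?thesis
      by (rule exI[of _ "\<lambda>g. L (\<lambda>M. g (?h M))"], rule conjI[OF push[OF L(1)]]) (use L(2) in \<open>simp only: sc\<close>)
  qed
  show "\<exists>L. balanced_on ?S L \<and>
       (L (\<lambda>p. sign_coord j p * sign_coord k p) = 0 \<longrightarrow>
        L (\<lambda>p. sign_coord i p * (sign_coord j p * sign_coord k p)) \<in> {-1, 0, 1})" if ijk: "i \<noteq> j" "i \<noteq> k"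
  proof -
    obtain L where L: "balanced_mean V ?K L"
      and L': "L (\<lambda>M. mem_sign (w j) M * mem_sign (w k) M) = 0 \<longrightarrow> L (\<lambda>M. mem_sign (w i) M * (mem_sign (w j) M * mem_sign (w k) M)) \<in> {-1, 0, 1}"
      using triple_mean[OF TK w(1)[of i] w(2)[OF ijk(1)] w(2)[OF ijk(2)]] by (elim exE conjE)
    show ?thesis
      by (rule exI[of _ "\<lambda>g. L (\<lambda>M. g (?h M))"], rule conjI[OF push[OF L]]) (use L' in \<open>simp only: sc\<close>)
  qed
qed

section \<open>Cocycle spaces are affinely independent\<close>

text \<open>The value at \<open>z\<close> of the character of \<open>{0,1}\<^sup>k\<close> with index \<open>c\<close>, which is -1 to the power
  \<open>\<Sum>j<k. c j * z j\<close>.\<close>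

definition character_sign :: "nat \<Rightarrow> (nat \<Rightarrow> nat) \<Rightarrow> (nat \<Rightarrow> nat) \<Rightarrow> real" where
  "character_sign k c z = (\<Prod>j<k. 1 - 2 * real (c j * z j))"

text \<open>The sum factorizes into sums over single coordinates.\<close>

lemma character_orthogonality:
  assumes z: "z \<in> binary_vectors k" and z': "z' \<in> binary_vectors k"
  shows "(\<Sum>c\<in>binary_vectors k. character_sign k c z * character_sign k c z') = (if z = z' then 2 ^ k else 0)"
proof -
  let ?f = "\<lambda>j b. (1 - 2 * real (b * z j)) * (1 - 2 * real (b * z' j))"
  have bin: "z j = 0 \<or> z j = 1" "z' j = 0 \<or> z' j = 1" if "j < k" for j
    using PiE_mem[of z "{..<k}" "\<lambda>_. {0, 1}" j] PiE_mem[of z' "{..<k}" "\<lambda>_. {0, 1}" j] z z' that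
    by (auto simp: binary_vectors_def)
  have "(\<Sum>c\<in>binary_vectors k. character_sign k c z * character_sign k c z') = (\<Sum>c\<in>binary_vectors k. \<Prod>j<k. ?f j (c j))"
    by (simp add: character_sign_def prod.distrib)
  also have "\<dots> = (\<Prod>j<k. \<Sum>b\<in>{0, 1}. ?f j b)"
    unfolding binary_vectors_def by (rule prod_sum_PiE[symmetric]) auto
  also have "\<dots> = (\<Prod>j<k. if z j = z' j then 2 else 0)"
  proof (rule prod.cong)
    fix j assume "j \<in> {..<k}"
    then show "(\<Sum>b\<in>{0, 1}. ?f j b) = (if z j = z' j then 2 else 0)" using bin[of j] by auto
  qed simp
  also have "\<dots> = (if z = z' then 2 ^ k else 0)"
  proof (cases "z = z'")
    case False
    then obtain j where j: "j < k" "z j \<noteq> z' j"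
      using PiE_ext[of z "{..<k}" "\<lambda>_. {0, 1}" z'] z z' by (auto simp: binary_vectors_def)
    then have "(\<Prod>j<k. if z j = z' j then 2 else 0 :: real) = 0" by (intro prod_zero) auto
    then show ?thesis using False by simp
  qed simp
  finally show ?thesis .
qed

text \<open>Up to signs, the coordinates of the points in \<open>{-1,1}\<close> are the values of the nontrivial characters, and an affine
  dependence also has total weight 0, which accounts for the trivial character. A dependence is therefore
  orthogonal to all characters and vanishes.\<close>

lemma cocycle_affine_independent:
  fixes S :: "(real^'r::finite) set"
  assumes iso: "cube_isomorphic S (PG_columns k) (cocycle_PG k)"
  shows "finite S" "S \<noteq> {}" "\<not> affine_dependent S"
proof -
  obtain \<sigma> :: "'r \<Rightarrow> nat \<Rightarrow> nat" and F where \<sigma>: "bij_betw \<sigma> UNIV (PG_columns k)"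
    and S: "S = (\<lambda>q. \<chi> i. if i \<in> F then 1 - real (q (\<sigma> i)) else real (q (\<sigma> i))) ` cocycle_PG k"
    using iso unfolding cube_isomorphic_def by blast
  have cc: "cocycle_PG k = (\<lambda>z. \<lambda>c\<in>PG_columns k. (\<Sum>j<k. c j * z j) mod 2) ` binary_vectors k"
    unfolding cocycle_PG_def by blast
  define \<Phi> where "\<Phi> = (\<lambda>z. (\<chi> i. if i \<in> F then 1 - real ((\<Sum>j<k. \<sigma> i j * z j) mod 2)
     else real ((\<Sum>j<k. \<sigma> i j * z j) mod 2)) :: real^'r)"
  have \<sigma>m: "\<sigma> i \<in> PG_columns k" for i using \<sigma> by (auto simp: bij_betw_def)
  have S': "S = \<Phi> ` binary_vectors k"
    unfolding S cc image_image by (rule image_cong) (simp_all add: \<Phi>_def vec_eq_iff \<sigma>m)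
  show fin: "finite S" unfolding S' using card_binary_vectors by simp
  have "binary_vectors k \<noteq> {}" using card_binary_vectors(2)[of k] by auto
  then show "S \<noteq> {}" unfolding S' by simp
  have bin: "c j = 0 \<or> c j = 1" if "c \<in> binary_vectors k" "j < k" for c j
    using PiE_mem[of c "{..<k}" "\<lambda>_. {0, 1}" j] that by (auto simp: binary_vectors_def)
  define \<epsilon> :: "'r \<Rightarrow> real" where "\<epsilon> = (\<lambda>i. if i \<in> F then -1 else 1)"
  have coord: "1 - 2 * \<Phi> z $ i = \<epsilon> i * character_sign k (\<sigma> i) z" if z: "z \<in> binary_vectors k" for z i
  proof -
    have "\<sigma> i \<in> binary_vectors k" using \<sigma>m by (simp add: PG_columns_def)
    then have "\<sigma> i j * z j \<in> {0, 1}" if "j < k" for j using bin[of "\<sigma> i" j] bin[OF z, of j] that by auto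
    then have "character_sign k (\<sigma> i) z = 1 - 2 * real ((\<Sum>j<k. \<sigma> i j * z j) mod 2)"
      unfolding character_sign_def by (intro prod_signs_parity) auto
    then show ?thesis by (simp add: \<Phi>_def \<epsilon>_def)
  qed
  show "\<not> affine_dependent S"
    unfolding affine_dependent_explicit_finite[OF fin]
  proof (intro notI, elim exE conjE)
    fix u assume sum0: "sum u S = 0" and ex: "\<exists>v\<in>S. u v \<noteq> 0" and comb: "(\<Sum>v\<in>S. u v *\<^sub>R v) = 0"
    \<comment> \<open>A parameter for each point, at which the characters are evaluated.\<close>
    define \<zeta> where "\<zeta> = inv_into (binary_vectors k) \<Phi>"
    have \<zeta>: "\<zeta> v \<in> binary_vectors k" "\<Phi> (\<zeta> v) = v" if "v \<in> S" for v
      using inv_into_into[of v \<Phi> "binary_vectors k"] f_inv_into_f[of v \<Phi> "binary_vectors k"] that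
      by (simp_all add: S' \<zeta>_def)
    have vanish: "(\<Sum>v\<in>S. u v * character_sign k c (\<zeta> v)) = 0" if c: "c \<in> binary_vectors k" for c
    proof (cases "c \<in> PG_columns k")
      case True
      then obtain i where i: "c = \<sigma> i" using \<sigma> by (auto simp: bij_betw_def)
      have "(\<Sum>v\<in>S. u v * v $ i) = 0" using comb by (simp add: vec_eq_iff)
      moreover have "(\<Sum>v\<in>S. u v * (1 - 2 * v $ i)) = sum u S - 2 * (\<Sum>v\<in>S. u v * v $ i)"
        by (simp add: algebra_simps sum_subtractf sum_distrib_left)
      ultimately have "0 = (\<Sum>v\<in>S. u v * (1 - 2 * v $ i))" using sum0 by simp
      also have "\<dots> = (\<Sum>v\<in>S. \<epsilon> i * (u v * character_sign k c (\<zeta> v)))"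
      proof (rule sum.cong)
        fix v assume "v \<in> S"
        then have "1 - 2 * v $ i = \<epsilon> i * character_sign k c (\<zeta> v)" using coord[OF \<zeta>(1), of v i] \<zeta>(2) i by simp
        then show "u v * (1 - 2 * v $ i) = \<epsilon> i * (u v * character_sign k c (\<zeta> v))" by simp
      qed simp
      also have "\<dots> = \<epsilon> i * (\<Sum>v\<in>S. u v * character_sign k c (\<zeta> v))" by (simp add: sum_distrib_left)
      finally show ?thesis by (auto simp: \<epsilon>_def split: if_splits)
    next
      case False
      then have "character_sign k c z = 1" for z using c by (auto simp: character_sign_def PG_columns_def)
      then show ?thesis using sum0 by simp
    qed
    obtain w where w: "w \<in> S" "u w \<noteq> 0" using ex by blast
    have "0 = (\<Sum>c\<in>binary_vectors k. character_sign k c (\<zeta> w) * (\<Sum>v\<in>S. u v * character_sign k c (\<zeta> v)))"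
      using vanish by simp
    also have "\<dots> = (\<Sum>v\<in>S. u v * (\<Sum>c\<in>binary_vectors k. character_sign k c (\<zeta> v) * character_sign k c (\<zeta> w)))"
      unfolding sum_distrib_left by (subst sum.swap) (simp add: mult_ac)
    also have "\<dots> = (\<Sum>v\<in>S. if v = w then u v * 2 ^ k else 0)"
    proof (rule sum.cong)
      fix v assume v: "v \<in> S"
      have "\<zeta> v = \<zeta> w \<longleftrightarrow> v = w" using \<zeta>(2) v w(1) by metis
      then show "u v * (\<Sum>c\<in>binary_vectors k. character_sign k c (\<zeta> v) * character_sign k c (\<zeta> w))
          = (if v = w then u v * 2 ^ k else 0)"
        using character_orthogonality[OF \<zeta>(1)[OF v] \<zeta>(1)[OF w(1)]] by simp
    qed simp
    also have "\<dots> = u w * 2 ^ k" using fin w(1) by simp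
    finally show False using w(2) by simp
  qed
qed

section \<open>Simplices spanned by points of the cube\<close>

text \<open>Every point of the cube with coordinates 0 and 1 is extreme in the convex hull, so it is
  a vertex of the simplex.\<close>

lemma simplex_hull_cube_points:
  fixes S :: "(real^'r::finite) set"
  assumes cube: "\<And>p i. p \<in> S \<Longrightarrow> p $ i = 0 \<or> p $ i = 1" and sim: "n simplex (convex hull S)"
  shows "\<not> affine_dependent S"
proof -
  obtain T where T: "\<not> affine_dependent T" "convex hull S = convex hull T"
    using sim by (auto simp: simplex_def)
  have "S \<subseteq> T"
  proof
    fix p assume p: "p \<in> S"
    have "p extreme_point_of (convex hull S)"
      unfolding extreme_point_of_def
    proof (intro conjI ballI notI)
      show "p \<in> convex hull S" using p by (rule hull_inc)
      fix a b assume ab: "a \<in> convex hull S" "b \<in> convex hull S" "p \<in> open_segment a b"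
      have box: "0 \<le> x $ i \<and> x $ i \<le> 1" if "x \<in> convex hull S" for x i
      proof -
        have "S \<subseteq> {x. 0 \<le> x $ i} \<inter> {x. x $ i \<le> 1}" using cube[where i = i] by fastforce
        moreover have "convex ({x::real^'r. 0 \<le> x $ i} \<inter> {x. x $ i \<le> 1})"
          by (intro convex_Int) (auto simp: convex_def intro: convex_bound_le)
        ultimately have "convex hull S \<subseteq> {x. 0 \<le> x $ i} \<inter> {x. x $ i \<le> 1}" by (rule hull_minimal)
        then show ?thesis using that by blast
      qed
      obtain t where t: "0 < t" "t < 1" "p = (1 - t) *\<^sub>R a + t *\<^sub>R b" and "a \<noteq> b"
        using ab(3) by (auto simp: in_segment)
      have "a $ i = b $ i" for i
      proof -
        have e: "p $ i = (1 - t) * a $ i + t * b $ i" using t(3) by simp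
        show ?thesis
        proof (cases "p $ i = 0")
          case True
          have nn: "0 \<le> (1 - t) * a $ i" "0 \<le> t * b $ i" using box[OF ab(1), of i] box[OF ab(2), of i] t by simp_all
          then have "(1 - t) * a $ i = 0" "t * b $ i = 0" using e True by linarith+
          then show ?thesis using t by simp
        next
          case False
          then have "p $ i = 1" using cube[OF p] by blast
          then have e': "(1 - t) * (1 - a $ i) + t * (1 - b $ i) = 0" using e by (simp add: algebra_simps)
          have nn: "0 \<le> (1 - t) * (1 - a $ i)" "0 \<le> t * (1 - b $ i)"
            using box[OF ab(1), of i] box[OF ab(2), of i] t by simp_all
          then have "(1 - t) * (1 - a $ i) = 0" "t * (1 - b $ i) = 0" using e' by linarith+
          then show ?thesis using t by simp
        qed
      qed
      then show False using \<open>a \<noteq> b\<close> by (simp add: vec_eq_iff)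
    qed
    then show "p \<in> T" unfolding T(2) by (rule extreme_point_of_convex_hull)
  qed
  then show ?thesis using T(1) affine_independent_subset by blast
qed

theorem theorem1p7:
  fixes V :: "'a set" and C :: "'a set set" and U W :: "'r::finite \<Rightarrow> 'a set"
  assumes "clutter V C" and "clean V C" and "tangled V C"
    and "component_bipartitions V C U W"
  shows "(\<exists>d::nat. int d simplex (convex hull (setcore V C U W))) \<longleftrightarrow>
         (\<exists>k\<ge>1. cube_isomorphic (setcore V C U W) (PG_columns k) (cocycle_PG k))"
proof
  note means = setcore_means[OF assms]
  assume "\<exists>d::nat. int d simplex (convex hull (setcore V C U W))"
  then obtain d :: nat where "int d simplex (convex hull (setcore V C U W))" by (elim exE)
  then have "\<not> affine_dependent (setcore V C U W)"
    by (rule simplex_hull_cube_points[rotated]) (rule means(2))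
  then show "\<exists>k\<ge>1. cube_isomorphic (setcore V C U W) (PG_columns k) (cocycle_PG k)"
    by (intro balanced_simplex_is_cocycle means)
next
  assume "\<exists>k\<ge>1. cube_isomorphic (setcore V C U W) (PG_columns k) (cocycle_PG k)"
  then obtain k where "cube_isomorphic (setcore V C U W) (PG_columns k) (cocycle_PG k)" by (elim exE conjE)
  note S = cocycle_affine_independent[OF this]
  have "card (setcore V C U W) > 0" using S(1,2) by (simp add: card_gt_0_iff)
  then have "int (card (setcore V C U W) - 1) simplex (convex hull (setcore V C U W))"
    unfolding simplex_def using S(3) by (intro exI[of _ "setcore V C U W"]) auto
  then show "\<exists>d::nat. int d simplex (convex hull (setcore V C U W))" by (rule exI)
qed

end
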